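(* Let $n\in\mathbb{Z}$ with $n\geq 1$, and let $\varepsilon_k>0$, $\xi_k>0$, $\alpha_k\geq 0$, $\tau_k\in\mathbb{R}$ for $k=1,\ldots,n$. Suppose that (1) $\displaystyle\sum_{k=1}^n\frac{1}{\xi_k}=\sum_{k=1}^n\frac{1}{\varepsilon_k}$; (2) $\displaystyle\sum_{k=1}^n\alpha_k>0$; (3) $\displaystyle\min_{1\leq k\leq n}\tau_k\xi_k>-1$. Let $$K_{(\varepsilon_k),(\xi_k),n}^{(\tau_k),(\alpha_k)}f(x)=\int_1^\infty H_{n,n}^{n,0}\left[\frac{1}{u}\left|\begin{matrix}(\tau_k+\alpha_k+1/\varepsilon_k,\,1/\varepsilon_k)_{1,n}\\(\tau_k+1/\xi_k,\,1/\xi_k)_{1,n}\end{matrix}\right.\right]f(xu)\,\mathrm{d}u ,$$ where $H_{n,n}^{n,0}$ is the Fox $H$-function. Then for every $f\in H^1(\mathbb{R})$, $$\left\|K_{(\varepsilon_k),(\xi_k),n}^{(\tau_k),(\alpha_k)}f\right\|_{H^1}\leq\mathsf{k}_2\,\|f\|_{H^1},$$ where $$\mathsf{k}_2=\int_1^\infty\left|H_{n,n}^{n,0}\left[\frac{1}{\sigma}\left|\begin{matrix}(\tau_k+\alpha_k+1/\varepsilon_k,\,1/\varepsilon_k)_{1,n}\\(\tau_k+1/\xi_k,\,1/\xi_k)_{1,n}\end{matrix}\right.\right]\right|\frac{\mathrm{d}\sigma}{\sigma}.$$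
   Context: **Fox $H$-function.** For parameters $a_k,b_k$ and $A_k,B_k>0$ ($k=1,\ldots,n$) with $\sum_{k=1}^n A_k=\sum_{k=1}^n B_k$, $$H_{n,n}^{n,0}\left[z\left|\begin{matrix}(a_k,A_k)_{1,n}\\(b_k,B_k)_{1,n}\end{matrix}\right.\right]=\frac{1}{2\pi\mathrm{i}}\int_{L}\prod_{k=1}^n\frac{\Gamma(B_ks+b_k)}{\Gamma(A_ks+a_k)}\,z^{-s}\,\mathrm{d}s,$$ where $(a_k,A_k)_{1,n}$ abbreviates $(a_1,A_1),\ldots,(a_n,A_n)$, and $L=L_{-\infty}$ is a left loop situated in a horizontal strip, starting at $-\infty+\mathrm{i}\varphi_1$ and terminating at $-\infty+\mathrm{i}\varphi_2$ with $-\infty<\varphi_1<\varphi_2<\infty$, which encloses all the poles of the functions $\Gamma(B_ks+b_k)$, $k=1,\ldots,n$. With this contour the $H$-function makes sense for $0<|z|<R$, where $R:=\prod_{k=1}^n A_k^{-A_k}\prod_{k=1}^n B_k^{B_k}$. **Hardy space.** A tempered distribution $f$ on $\mathbb{R}$ is called bounded if $f*\varphi\in L^\infty(\mathbb{R})$ for every Schwartz function $\varphi$. Let $P(x)=\frac{1}{\pi}\frac{1}{1+|x|^2}$ and $P_t(x)=t^{-1}P(x/t)$ for $t>0$. A bounded tempered distribution $f$ belongs to $H^1=H^1(\mathbb{R})$ if the Poisson maximal function $M_Pf(x)=\sup_{t>0}|(P_t*f)(x)|$ lies in $L^1(\mathbb{R})$, and then $\|f\|_{H^1}=\|M_Pf\|_{L^1}$.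 It is known that $H^1\subset L^1(\mathbb{R})$. *)

theory Defs
  imports "HOL-Complex_Analysis.Complex_Analysis"
begin

section \<open>The Fox H-function\<close>

definition fox_poles :: "nat \<Rightarrow> (nat \<Rightarrow> complex) \<Rightarrow> (nat \<Rightarrow> real) \<Rightarrow> complex set" where
  "fox_poles n b B = {s. \<exists>k\<in>{1..n}. of_real (B k) * s + b k \<in> \<int>\<^sub>\<le>\<^sub>0}"

definition fox_radius :: "nat \<Rightarrow> (nat \<Rightarrow> real) \<Rightarrow> (nat \<Rightarrow> real) \<Rightarrow> real" where
  "fox_radius n A B = (\<Prod>k=1..n. A k powr (- A k)) * (\<Prod>k=1..n. B k powr B k)"

text \<open>
  The left loops used here run from \<open>-\<infinity> + \<i>\<phi>\<^sub>1\<close> horizontally to \<open>c + \<i>\<phi>\<^sub>1\<close>, then vertically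
  to \<open>c + \<i>\<phi>\<^sub>2\<close>, then horizontally back to \<open>-\<infinity> + \<i>\<phi>\<^sub>2\<close>. Such a loop encloses a set of
  points iff these lie to the left of \<open>c\<close> and strictly between the two horizontal rays.
  By Cauchy's theorem the H-function does not depend on the loop.
\<close>

definition left_loop_encloses :: "real \<Rightarrow> real \<Rightarrow> real \<Rightarrow> complex set \<Rightarrow> bool" where
  "left_loop_encloses \<phi>1 \<phi>2 c S \<longleftrightarrow>
     \<phi>1 < \<phi>2 \<and> (\<forall>s\<in>S. Re s < c \<and> \<phi>1 < Im s \<and> Im s < \<phi>2)"

definition left_loop_integral ::
  "real \<Rightarrow> real \<Rightarrow> real \<Rightarrow> (complex \<Rightarrow> complex) \<Rightarrow> complex" where
  "left_loop_integral \<phi>1 \<phi>2 c g =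
     (LBINT x:{..c}. g (Complex x \<phi>1))
     + contour_integral (linepath (Complex c \<phi>1) (Complex c \<phi>2)) g
     - (LBINT x:{..c}. g (Complex x \<phi>2))"

text \<open>
  The loop integral converges for \<open>0 < \<bar>z\<bar> < fox_radius n A B\<close>. For \<open>\<bar>z\<bar>\<close> greater than
  the radius the function is zero by convention, which is its value when the left loop
  is replaced by a right loop (there are no poles on the right to be enclosed).
  Since \<open>Gamma\<close> is \<open>0\<close> at its poles in HOL, \<open>1 / Gamma w\<close> is the entire reciprocal
  Gamma function.
\<close>

definition fox_H ::
  "real \<Rightarrow> real \<Rightarrow> real \<Rightarrow> nat \<Rightarrow> (nat \<Rightarrow> complex) \<Rightarrow> (nat \<Rightarrow> real) \<Rightarrow>
   (nat \<Rightarrow> complex) \<Rightarrow> (nat \<Rightarrow> real) \<Rightarrow> complex \<Rightarrow> complex" where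
  "fox_H \<phi>1 \<phi>2 c n a A b B z =
     (if 0 < norm z \<and> norm z < fox_radius n A B
      then 1 / (2 * of_real pi * \<i>) *
           left_loop_integral \<phi>1 \<phi>2 c
             (\<lambda>s. (\<Prod>k=1..n. Gamma (of_real (B k) * s + b k) / Gamma (of_real (A k) * s + a k))
                  * z powr (- s))
      else 0)"


section \<open>Tempered distributions on the real line\<close>

definition nth_deriv :: "nat \<Rightarrow> (real \<Rightarrow> complex) \<Rightarrow> real \<Rightarrow> complex" where
  "nth_deriv k \<phi> = ((\<lambda>g x. vector_derivative g (at x)) ^^ k) \<phi>"

definition schwartz :: "(real \<Rightarrow> complex) set" where
  "schwartz = {\<phi>. (\<forall>k x. nth_deriv k \<phi> differentiable (at x)) \<and>
                  (\<forall>m k. bounded (range (\<lambda>x. x ^ m *\<^sub>R nth_deriv k \<phi> x)))}"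

definition schwartz_tendsto_zero :: "(nat \<Rightarrow> real \<Rightarrow> complex) \<Rightarrow> bool" where
  "schwartz_tendsto_zero \<Phi> \<longleftrightarrow>
     (\<forall>m k. uniform_limit UNIV (\<lambda>j x. x ^ m *\<^sub>R nth_deriv k (\<Phi> j) x) (\<lambda>_. 0) sequentially)"

text \<open>
  A distribution is a functional on all functions, of which only the values on \<open>schwartz\<close>
  matter. The Schwartz topology is metrizable, so sequential continuity at \<open>0\<close> of a linear
  functional is continuity.
\<close>

type_synonym distribution = "(real \<Rightarrow> complex) \<Rightarrow> complex"

definition tempered :: "distribution \<Rightarrow> bool" where
  "tempered T \<longleftrightarrow>
     (\<forall>\<phi>\<in>schwartz. \<forall>\<psi>\<in>schwartz. \<forall>p q. T (\<lambda>x. p * \<phi> x + q * \<psi> x) = p * T \<phi> + q * T \<psi>) \<and>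
     (\<forall>\<Phi>. range \<Phi> \<subseteq> schwartz \<longrightarrow> schwartz_tendsto_zero \<Phi> \<longrightarrow> (\<lambda>j. T (\<Phi> j)) \<longlonglongrightarrow> 0)"

definition regular_distribution :: "(real \<Rightarrow> complex) \<Rightarrow> distribution" where
  "regular_distribution f = (\<lambda>\<phi>. LBINT x. f x * \<phi> x)"

definition dist_conv :: "distribution \<Rightarrow> (real \<Rightarrow> complex) \<Rightarrow> real \<Rightarrow> complex" where
  "dist_conv T \<phi> x = T (\<lambda>y. \<phi> (x - y))"

definition bounded_distribution :: "distribution \<Rightarrow> bool" where
  "bounded_distribution T \<longleftrightarrow>
     tempered T \<and> (\<forall>\<phi>\<in>schwartz. \<exists>C. AE x in lborel. norm (dist_conv T \<phi> x) \<le> C)"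


section \<open>The Hardy space $H^1$\<close>

definition poisson :: "real \<Rightarrow> real" where
  "poisson x = 1 / pi * (1 / (1 + \<bar>x\<bar>\<^sup>2))"

definition poisson_t :: "real \<Rightarrow> real \<Rightarrow> real" where
  "poisson_t t x = poisson (x / t) / t"

text \<open>
  The Poisson kernel is not a Schwartz function. For a bounded distribution \<open>T\<close> and an
  integrable \<open>h\<close>, the distribution \<open>h * T\<close> is defined by
  \<open>\<langle>h * T, \<phi>\<rangle> = \<integral> (T * \<phi>\<^sup>~)(y) h(-y) dy\<close> with \<open>\<phi>\<^sup>~(w) = \<phi>(-w)\<close>. For \<open>h = P\<^sub>t\<close> it is given by a
  unique bounded continuous function, which is denoted \<open>P\<^sub>t * T\<close>.
\<close>

definition poisson_conv :: "real \<Rightarrow> distribution \<Rightarrow> real \<Rightarrow> complex" where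
  "poisson_conv t T =
     (THE g. continuous_on UNIV g \<and> bounded (range g) \<and>
        (\<forall>\<phi>\<in>schwartz. (LBINT x. g x * \<phi> x) =
           (LBINT y. dist_conv T (\<lambda>w. \<phi> (- w)) y * of_real (poisson_t t (- y)))))"

definition poisson_maximal :: "distribution \<Rightarrow> real \<Rightarrow> ennreal" where
  "poisson_maximal T x = (SUP t\<in>{0<..}. ennreal (norm (poisson_conv t T x)))"

definition H1_norm :: "distribution \<Rightarrow> ennreal" where
  "H1_norm T = (\<integral>\<^sup>+ x. poisson_maximal T x \<partial>lborel)"

definition hardy_H1 :: "distribution set" where
  "hardy_H1 = {T. bounded_distribution T \<and>
                  poisson_maximal T \<in> borel_measurable lborel \<and> H1_norm T < \<infinity>}"

text \<open>
  Since every element of \<open>H\<^sup>1\<close> is (the distribution of) an integrable function, \<open>H\<^sup>1\<close> is also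
  regarded as a set of functions.
\<close>

definition H1_fun :: "(real \<Rightarrow> complex) set" where
  "H1_fun = {f. integrable lborel f \<and> regular_distribution f \<in> hardy_H1}"

definition H1_fun_norm :: "(real \<Rightarrow> complex) \<Rightarrow> ennreal" where
  "H1_fun_norm f = H1_norm (regular_distribution f)"


section \<open>The operator and its constant\<close>

definition K_kernel ::
  "real \<Rightarrow> real \<Rightarrow> real \<Rightarrow> nat \<Rightarrow> (nat \<Rightarrow> real) \<Rightarrow> (nat \<Rightarrow> real) \<Rightarrow> (nat \<Rightarrow> real) \<Rightarrow>
   (nat \<Rightarrow> real) \<Rightarrow> real \<Rightarrow> complex" where
  "K_kernel \<phi>1 \<phi>2 c n \<epsilon> \<xi> \<tau> \<alpha> u =
     fox_H \<phi>1 \<phi>2 c n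
       (\<lambda>k. of_real (\<tau> k + \<alpha> k + 1 / \<epsilon> k)) (\<lambda>k. 1 / \<epsilon> k)
       (\<lambda>k. of_real (\<tau> k + 1 / \<xi> k)) (\<lambda>k. 1 / \<xi> k) (of_real (1 / u))"

definition K_op ::
  "real \<Rightarrow> real \<Rightarrow> real \<Rightarrow> nat \<Rightarrow> (nat \<Rightarrow> real) \<Rightarrow> (nat \<Rightarrow> real) \<Rightarrow> (nat \<Rightarrow> real) \<Rightarrow>
   (nat \<Rightarrow> real) \<Rightarrow> (real \<Rightarrow> complex) \<Rightarrow> real \<Rightarrow> complex" where
  "K_op \<phi>1 \<phi>2 c n \<epsilon> \<xi> \<tau> \<alpha> f x =
     (LBINT u:{1..}. K_kernel \<phi>1 \<phi>2 c n \<epsilon> \<xi> \<tau> \<alpha> u * f (x * u))"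

definition k2 ::
  "real \<Rightarrow> real \<Rightarrow> real \<Rightarrow> nat \<Rightarrow> (nat \<Rightarrow> real) \<Rightarrow> (nat \<Rightarrow> real) \<Rightarrow> (nat \<Rightarrow> real) \<Rightarrow>
   (nat \<Rightarrow> real) \<Rightarrow> ennreal" where
  "k2 \<phi>1 \<phi>2 c n \<epsilon> \<xi> \<tau> \<alpha> =
     (\<integral>\<^sup>+ \<sigma>\<in>{1..}. ennreal (norm (K_kernel \<phi>1 \<phi>2 c n \<epsilon> \<xi> \<tau> \<alpha> \<sigma>) / \<sigma>) \<partial>lborel)"

end

(*
The kernel. On a horizontal ray s = -y + i phi with phi not zero, Stirling's formula gives
|prod_k Gamma(B_k s + b_k) / Gamma(A_k s + a_k)| <= C R^(-y) y^(-mu) with mu = sum_k (a_k - b_k) = sum_k alpha_k > 0,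
because sum_k A_k = sum_k B_k. The vertical side of the loop can be moved to a line Re s = c' < 0, since all
poles have negative real part. Hence |H(1/u)| is at most a constant times the integral of (uR)^(-y) y^(-mu)
over y >= -c', plus a constant times u^c'. The integral of (uR)^(-y) du/u over u > 1/R is 1/y, so Tonelli's
theorem bounds the constant of the theorem by the convergent integral of y^(-mu-1). No asymptotics of H
at the singularity |z| = R are needed.

The operator. Since u P_{tu}(u v) = P_t(v), one has
P_t * (K f) (x) = integral over u >= 1 of H(1/u) (P_{tu} * f)(xu) du, so that
M_P (K f) (x) <= integral of |H(1/u)| M_P f(xu) du, and integrating over x gives the factor 1/u.
*)

theory Submission
  imports Defs "HOL-Real_Asymp.Real_Asymp" "HOL-Probability.Distributions"
begin

section \<open>Stirling's formula on horizontal lines\<close>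

text \<open>The point \<open>|z| = R\<close> is \<open>u = 1 / R\<close>. Depending on the
  parameters it may lie inside the range \<open>u \<ge> 1\<close>, and the kernel may be unbounded
  there; hence the absolute values on the two rays are integrated over \<open>u\<close> instead of
  being bounded pointwise. A given loop may have \<open>c \<ge> 0\<close>, and its vertical side
  would then only give the bound u^(c-1), which is not integrable at infinity. Hypothesis (3) puts
  all poles on the negative real axis, which leaves room to move this side to the left of 0. The
  other obstacle is the meaning of P_t * T, a definite description in terms of pairings with
  Schwartz functions. Before the dilation identity can be used, it has to be identified with the
  ordinary convolution integral, and this requires that pairings with Schwartz functions determine a
  bounded continuous function. Gaussians concentrating at a point show that they do.\<close>

lemma bigo_inverse_square_if_tendsto:
  fixes f :: "real \<Rightarrow> real"
  assumes "((\<lambda>y. y\<^sup>2 * f y) \<longlongrightarrow> L) at_top"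
  shows "f \<in> O(\<lambda>y. 1 / y\<^sup>2)"
proof (rule bigoI_tendsto)
  show "((\<lambda>y. f y / (1 / y\<^sup>2)) \<longlongrightarrow> L) at_top"
    using assms by (simp add: mult.commute)
  show "eventually (\<lambda>y::real. 1 / y\<^sup>2 \<noteq> 0) at_top"
    using eventually_gt_at_top[of 0] by eventually_elim simp
qed

text \<open>The logarithm of the ratio of |Gamma(p - y + i \<eta>)| to y^(p - y - 1/2) e^y, the size
  predicted by Stirling's formula together with the reflection formula. The sine in the reflection
  formula leaves a factor of period 1 in y, so the ratio has no limit and boundedness is the natural
  claim.\<close>

definition Gamma_defect :: "real \<Rightarrow> real \<Rightarrow> real \<Rightarrow> real" where
  "Gamma_defect p \<eta> y = ln (norm (Gamma (Complex (p - y) \<eta>))) + (y + 1/2 - p) * ln y - y"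

lemma complex_nonpos_IntsD: "w \<in> \<int>\<^sub>\<le>\<^sub>0 \<Longrightarrow> Re w \<le> 0 \<and> Im w = 0"
  by (auto elim!: nonpos_Ints_cases)

lemma Complex_notin_nonpos_Ints: "\<eta> \<noteq> 0 \<Longrightarrow> Complex x \<eta> \<notin> \<int>\<^sub>\<le>\<^sub>0"
  using complex_nonpos_IntsD by force

text \<open>This is Gamma(w + 1) = w Gamma(w) at w = p - (y + 1) + i \<eta>. The terms p/y are
  inserted with opposite signs so that each of the three groups is O(1/y^2).\<close>

lemma Gamma_defect_step:
  assumes "\<eta> \<noteq> 0" "y > 0"
  shows "Gamma_defect p \<eta> (y + 1) - Gamma_defect p \<eta> y =
    ((y + 1/2) * ln (1 + 1/y) - 1) - p * (ln (1 + 1/y) - 1/y)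
    - (ln (1 + ((p\<^sup>2 + \<eta>\<^sup>2) - 2 * p * (y + 1)) / (y + 1)\<^sup>2) + 2 * p / y) / 2"
proof -
  let ?w = "Complex (p - (y + 1)) \<eta>"
  have w0: "?w \<noteq> 0" using assms by (simp add: complex_eq_iff)
  have "Gamma (Complex (p - y) \<eta>) = Gamma (?w + 1)"
    by (rule arg_cong[of _ _ Gamma]) (simp add: complex_eq_iff)
  also have "\<dots> = ?w * Gamma ?w"
    by (rule Gamma_plus1) (use assms Complex_notin_nonpos_Ints in auto)
  finally have "ln (norm (Gamma (Complex (p - y) \<eta>))) = ln (norm ?w) + ln (norm (Gamma ?w))"
    using w0 assms Complex_notin_nonpos_Ints by (simp add: norm_mult ln_mult Gamma_eq_zero_iff)
  moreover have "ln (norm ?w) = ln (y + 1) + ln (1 + ((p\<^sup>2 + \<eta>\<^sup>2) - 2 * p * (y + 1)) / (y + 1)\<^sup>2) / 2"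
  proof -
    have e: "(norm ?w)\<^sup>2 = (y + 1)\<^sup>2 * (1 + ((p\<^sup>2 + \<eta>\<^sup>2) - 2 * p * (y + 1)) / (y + 1)\<^sup>2)"
    proof -
      have "(norm ?w)\<^sup>2 = (y + 1)\<^sup>2 + ((p\<^sup>2 + \<eta>\<^sup>2) - 2 * p * (y + 1))"
        unfolding cmod_power2 by (simp add: power2_eq_square algebra_simps)
      moreover have "a\<^sup>2 * (1 + b / a\<^sup>2) = a\<^sup>2 + b" if "a \<noteq> 0" for a b :: real
        using that by (simp add: distrib_left)
      ultimately show ?thesis using assms by simp
    qed
    have "(y + 1)\<^sup>2 * (1 + ((p\<^sup>2 + \<eta>\<^sup>2) - 2 * p * (y + 1)) / (y + 1)\<^sup>2) > 0"
      unfolding e[symmetric] using w0 by simp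
    then have "1 + ((p\<^sup>2 + \<eta>\<^sup>2) - 2 * p * (y + 1)) / (y + 1)\<^sup>2 > 0"
      by (rule zero_less_mult_pos) (use assms in simp)
    then have "ln ((norm ?w)\<^sup>2) = 2 * ln (y + 1) + ln (1 + ((p\<^sup>2 + \<eta>\<^sup>2) - 2 * p * (y + 1)) / (y + 1)\<^sup>2)"
      unfolding e using assms by (simp add: ln_mult ln_realpow)
    then show ?thesis using w0 by (simp add: ln_realpow)
  qed
  moreover have "ln (1 + 1 / y) = ln (y + 1) - ln y"
    using assms ln_div[of "y + 1" y] by (simp add: add_divide_distrib add.commute)
  moreover have "2 * p / y / 2 = p * (1 / y)" by simp
  ultimately show ?thesis
    unfolding Gamma_defect_def add_divide_distrib[of _ "2 * p / y"]
    by (simp only:) (simp add: algebra_simps)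
qed

lemma Gamma_defect_step_bigo:
  assumes "\<eta> \<noteq> 0"
  shows "(\<lambda>y. Gamma_defect p \<eta> (y + 1) - Gamma_defect p \<eta> y) \<in> O(\<lambda>y. 1 / y\<^sup>2)"
proof -
  define q where "q = p\<^sup>2 + \<eta>\<^sup>2"
  \<comment> \<open>The logarithm expands as -2p/y + (2p + q - 2p^2)/y^2 + ...; adding 2p/y removes
    the first term, and the limit is the next coefficient.\<close>
  have "((\<lambda>y. y\<^sup>2 * (ln (1 + (q - 2 * p * (y + 1)) / (y + 1)\<^sup>2) + 2 * p / y))
          \<longlongrightarrow> 2 * p + q - 2 * p * p) at_top"
    by real_asymp
  then have 1: "(\<lambda>y. ln (1 + (q - 2 * p * (y + 1)) / (y + 1)\<^sup>2) + 2 * p / y) \<in> O(\<lambda>y. 1 / y\<^sup>2)"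
    by (rule bigo_inverse_square_if_tendsto)
  have 2: "(\<lambda>y::real. (y + 1/2) * ln (1 + 1/y) - 1) \<in> O(\<lambda>y. 1 / y\<^sup>2)"
    and 3: "(\<lambda>y::real. ln (1 + 1/y) - 1/y) \<in> O(\<lambda>y. 1 / y\<^sup>2)"
    by real_asymp+
  have 4: "(\<lambda>y. ((y + 1/2) * ln (1 + 1/y) - 1) - p * (ln (1 + 1/y) - 1/y)
      - (ln (1 + (q - 2 * p * (y + 1)) / (y + 1)\<^sup>2) + 2 * p / y) / 2) \<in> O(\<lambda>y. 1 / y\<^sup>2)"
  proof (intro sum_in_bigo(2)[OF sum_in_bigo(2)])
    show "(\<lambda>y. p * (ln (1 + 1/y) - 1/y)) \<in> O(\<lambda>y. 1 / y\<^sup>2)"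
      using 3 by (cases "p = 0") simp_all
  qed (rule 2, use 1 in simp)
  show ?thesis
    by (rule landau_o.big.in_cong[THEN iffD2, OF _ 4])
       (use eventually_gt_at_top[of 0] in eventually_elim, simp add: Gamma_defect_step[OF assms] q_def)
qed

lemma Gamma_defect_continuous_on:
  assumes "\<eta> \<noteq> 0"
  shows "continuous_on {0<..} (Gamma_defect p \<eta>)"
proof -
  have "continuous_on {0<..} (\<lambda>y. Complex (p - y) \<eta>)"
    unfolding Complex_eq by (intro continuous_intros)
  then have "continuous_on {0<..} (\<lambda>y. Gamma (Complex (p - y) \<eta>))"
    by (intro continuous_on_compose2[OF continuous_on_Gamma[of "- \<int>\<^sub>\<le>\<^sub>0"]])
       (use assms Complex_notin_nonpos_Ints in auto)
  then show ?thesis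
    unfolding Gamma_defect_def[abs_def]
    by (intro continuous_intros) (use assms Complex_notin_nonpos_Ints in \<open>auto simp: Gamma_eq_zero_iff\<close>)
qed

text \<open>Only the boundedness of the error in Stirling's formula is needed. It follows from the
  functional equation, because the increments of the error are summable.\<close>

lemma Gamma_defect_bounded:
  assumes \<eta>: "\<eta> \<noteq> 0" and y0: "y0 > 0"
  shows "\<exists>C. \<forall>y\<ge>y0. \<bar>Gamma_defect p \<eta> y\<bar> \<le> C"
proof -
  let ?D = "Gamma_defect p \<eta>"
  obtain M where M: "M > 0" "eventually (\<lambda>y. norm (?D (y + 1) - ?D y) \<le> M * norm (1 / y\<^sup>2)) at_top"
    using landau_o.bigE[OF Gamma_defect_step_bigo[OF \<eta>]] by blast
  then obtain Y0 where Y0: "\<And>y. y \<ge> Y0 \<Longrightarrow> norm (?D (y + 1) - ?D y) \<le> M * norm (1 / y\<^sup>2)"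
    by (auto simp: eventually_at_top_linorder)
  \<comment> \<open>Above \<open>Y\<close> the increment estimate holds, and
    \<open>Y \<ge> 2\<close> keeps the denominators y - 1 of the telescoping sum positive.\<close>
  define Y where "Y = max (max Y0 2) y0"
  have telescope: "\<bar>?D (y + real n) - ?D y\<bar> \<le> M * (1 / (y - 1) - 1 / (y + real n - 1))" if "y \<ge> Y" for y n
  proof (induction n)
    case (Suc n)
    let ?z = "y + real n"
    have z: "?z \<ge> Y0" "?z \<ge> 2" using that by (auto simp: Y_def)
    \<comment> \<open>1/z^2 is at most 1/(z (z - 1)), a difference that telescopes under z -> z + 1.
      The total over any number of unit steps therefore stays below M.\<close>
    have "1 / ?z\<^sup>2 \<le> 1 / (?z - 1) - 1 / ?z"
      using z by (simp add: divide_simps power2_eq_square)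
    then have "M * norm (1 / ?z\<^sup>2) \<le> M * (1 / (?z - 1) - 1 / ?z)"
      using M(1) by (intro mult_left_mono) auto
    with Y0[OF z(1)] have "\<bar>?D (?z + 1) - ?D ?z\<bar> \<le> M * (1 / (?z - 1) - 1 / ?z)"
      by simp
    with Suc.IH have "\<bar>?D (?z + 1) - ?D y\<bar> \<le> M * (1 / (y - 1) - 1 / (?z - 1)) + M * (1 / (?z - 1) - 1 / ?z)"
      by linarith
    then show ?case by (simp add: algebra_simps)
  qed auto
  have "compact (?D ` {y0..Y + 1})"
    by (rule compact_continuous_image[OF continuous_on_subset[OF Gamma_defect_continuous_on[OF \<eta>]]])
       (use y0 in auto)
  then obtain B where "\<forall>y\<in>{y0..Y + 1}. \<bar>?D y\<bar> \<le> B"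
    using compact_imp_bounded[of "?D ` {y0..Y + 1}"] by (auto simp: bounded_iff)
  then have B: "\<And>y. y \<in> {y0..Y + 1} \<Longrightarrow> \<bar>?D y\<bar> \<le> B" by blast
  have "\<bar>?D y\<bar> \<le> B + M" if "y \<ge> y0" for y
  proof (cases "y \<le> Y + 1")
    case True
    then show ?thesis using B[of y] that M(1) by auto
  next
    case False
    \<comment> \<open>Unit steps lead from y back to a point x of the compact interval from Y to Y +
      1, where B bounds the defect.\<close>
    define n where "n = nat \<lfloor>y - Y\<rfloor>"
    define x where "x = y - real n"
    have "real n \<le> y - Y" "y - Y < real n + 1"
      using False by (auto simp: n_def of_nat_nat) 
    then have x: "x \<ge> Y" "x \<le> Y + 1" by (auto simp: x_def)
    then have x': "x \<ge> y0" "x \<ge> 2" by (auto simp: Y_def)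
    have "1 / (x - 1) \<le> 1" "1 / (x + real n - 1) \<ge> 0"
      using x' by (auto simp: divide_le_eq)
    then have "1 / (x - 1) - 1 / (x + real n - 1) \<le> 1"
      by linarith
    then have "M * (1 / (x - 1) - 1 / (x + real n - 1)) \<le> M * 1"
      using M(1) by (intro mult_left_mono) auto
    moreover have "\<bar>?D x\<bar> \<le> B" using x x' by (intro B) simp
    moreover have "x + real n = y" by (simp add: x_def)
    ultimately show ?thesis
      using telescope[OF x(1), of n] by simp
  qed
  then show ?thesis by blast
qed

section \<open>The Fox H-function on the positive axis\<close>

text \<open>On the ray the argument is p - A y + i A \<phi>, so \<open>Gamma_defect\<close> applies
  at \<open>A * y\<close>. Expanding ln(A y) produces the linear term with A ln A, from which the
  radius arises later, and a constant that goes into C.\<close>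

lemma Gamma_ray_bounds:
  fixes A p \<phi> y0 :: real
  assumes "A > 0" "\<phi> \<noteq> 0" "y0 > 0"
  shows "\<exists>C. \<forall>y\<ge>y0. \<bar>ln (norm (Gamma (of_real A * Complex (- y) \<phi> + of_real p)))
    - (A * y - A * ln A * y - (A * y + 1/2 - p) * ln y)\<bar> \<le> C"
proof -
  obtain C where C: "\<And>y. y \<ge> A * y0 \<Longrightarrow> \<bar>Gamma_defect p (A * \<phi>) y\<bar> \<le> C"
    using Gamma_defect_bounded[of "A * \<phi>" "A * y0" p] assms by auto
  have "\<bar>ln (norm (Gamma (of_real A * Complex (- y) \<phi> + of_real p)))
    - (A * y - A * ln A * y - (A * y + 1/2 - p) * ln y)\<bar> \<le> C + \<bar>(1/2 - p) * ln A\<bar>" if "y \<ge> y0" for y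
  proof -
    have "of_real A * Complex (- y) \<phi> + of_real p = Complex (p - A * y) (A * \<phi>)"
      by (simp add: complex_eq_iff)
    moreover have "ln (A * y) = ln A + ln y"
      using assms that by (simp add: ln_mult)
    ultimately have "ln (norm (Gamma (of_real A * Complex (- y) \<phi> + of_real p)))
        - (A * y - A * ln A * y - (A * y + 1/2 - p) * ln y)
        = Gamma_defect p (A * \<phi>) (A * y) - (1/2 - p) * ln A"
      by (simp add: Gamma_defect_def algebra_simps)
    then show ?thesis
      using C[of "A * y"] that assms abs_triangle_ineq4[of "Gamma_defect p (A * \<phi>) (A * y)" "(1/2 - p) * ln A"]
      by simp
  qed
  then show ?thesis by blast
qed

lemma nn_integral_powr_atLeast:
  fixes x0 t :: real
  assumes "x0 > 0" "t < 0"
  shows "(\<integral>\<^sup>+x\<in>{x0..}. ennreal (x powr (t - 1)) \<partial>lborel) = ennreal (x0 powr t / (- t))"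
proof -
  have "((\<lambda>x::real. x powr t) \<longlongrightarrow> 0) at_top"
    using assms tendsto_neg_powr[of t "\<lambda>x. x" at_top] filterlim_ident by blast
  then have lim: "((\<lambda>x::real. x powr t / t) \<longlongrightarrow> 0 / t) at_top"
    using assms by (intro tendsto_intros) auto
  have "(\<integral>\<^sup>+x\<in>{x0..}. ennreal (x powr (t - 1)) \<partial>lborel) = ennreal (0 / t - x0 powr t / t)"
    using assms lim
    by (intro nn_integral_FTC_atLeast) (auto intro!: derivative_eq_intros)
  then show ?thesis by simp
qed

lemma nn_integral_exp_decay:
  fixes y0 q :: real
  assumes "q > 1"
  shows "(\<integral>\<^sup>+y\<in>{y0..}. ennreal (q powr (- y)) \<partial>lborel) < \<infinity>"
proof -
  have "((\<lambda>y. - (q powr (- y) / ln q)) \<longlongrightarrow> 0) at_top"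
    using assms by real_asymp
  then have "(\<integral>\<^sup>+y\<in>{y0..}. ennreal (q powr (- y)) \<partial>lborel) = ennreal (0 - (- (q powr (- y0) / ln q)))"
    using assms by (intro nn_integral_FTC_atLeast)
      (auto intro!: derivative_eq_intros simp: field_simps)
  then show ?thesis by simp
qed

lemma nn_integral_reflect:
  fixes f :: "real \<Rightarrow> ennreal"
  assumes [measurable]: "f \<in> borel_measurable borel"
  shows "(\<integral>\<^sup>+x. f x \<partial>lborel) = (\<integral>\<^sup>+x. f (- x) \<partial>lborel)"
  using nn_integral_real_affine[of f "-1" 0] by simp

text \<open>In the application \<open>b k = (\<tau> k * \<xi> k + 1) / \<xi> k\<close>, so
  \<open>b_pos\<close> is hypothesis (3). Since the sums of \<open>1 / \<xi> k\<close> and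
  \<open>1 / \<epsilon> k\<close> agree, \<open>order_pos\<close> is hypothesis (2).\<close>

locale fox_parameters =
  fixes n :: nat and a A b B :: "nat \<Rightarrow> real"
  assumes n_pos: "n \<ge> 1"
    and A_pos: "\<And>k. k \<in> {1..n} \<Longrightarrow> A k > 0"
    and B_pos: "\<And>k. k \<in> {1..n} \<Longrightarrow> B k > 0"
    and b_pos: "\<And>k. k \<in> {1..n} \<Longrightarrow> b k > 0"
    and balanced: "(\<Sum>k=1..n. A k) = (\<Sum>k=1..n. B k)"
    and order_pos: "(\<Sum>k=1..n. b k) < (\<Sum>k=1..n. a k)"
begin

section \<open>Decay of the Gamma quotient on horizontal rays\<close>

definition gamma_quotient :: "complex \<Rightarrow> complex" where
  "gamma_quotient s = (\<Prod>k=1..n. Gamma (of_real (B k) * s + of_real (b k)) / Gamma (of_real (A k) * s + of_real (a k)))"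

definition order :: real where
  "order = (\<Sum>k=1..n. a k) - (\<Sum>k=1..n. b k)"

abbreviation R :: real where "R \<equiv> fox_radius n A B"

text \<open>The rightmost pole of the numerator factors: those of the k-th factor are -(b k + j) / B
  k for j = 0, 1, ...\<close>

definition abscissa :: real where
  "abscissa = - Min ((\<lambda>k. b k / B k) ` {1..n})"

lemma order_gt_0: "order > 0"
  using order_pos by (simp add: order_def)

lemma R_pos: "R > 0"
proof -
  have "A k powr (- A k) > 0" "B k powr B k > 0" if "k \<in> {1..n}" for k
    using A_pos[OF that] B_pos[OF that] by simp_all
  then show ?thesis by (auto simp: fox_radius_def intro!: mult_pos_pos prod_pos)
qed

lemma ln_R: "ln R = (\<Sum>k=1..n. B k * ln (B k)) - (\<Sum>k=1..n. A k * ln (A k))"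
proof -
  have A0: "A k \<noteq> 0" and B0: "B k \<noteq> 0" if "k \<in> {1..n}" for k
    using A_pos[OF that] B_pos[OF that] by simp_all
  have "ln R = ln (\<Prod>k=1..n. A k powr (- A k)) + ln (\<Prod>k=1..n. B k powr B k)"
    unfolding fox_radius_def using A0 B0 by (intro ln_mult_pos prod_pos) auto
  also have "\<dots> = (\<Sum>k=1..n. ln (A k powr (- A k))) + (\<Sum>k=1..n. ln (B k powr B k))"
    using A0 B0 by (subst (1 2) ln_prod) auto
  also have "\<dots> = (\<Sum>k=1..n. - (A k * ln (A k))) + (\<Sum>k=1..n. B k * ln (B k))"
    using A0 B0 by (simp add: ln_powr)
  finally show ?thesis by (simp add: sum_negf)
qed

text \<open>The factors of size y^(A y) cancel because the sums of \<open>A\<close> and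
  \<open>B\<close> agree. The linear terms in the exponent add up to -y ln R. In the logarithmic
  ones the summands 1/2 cancel, as there are \<open>n\<close> factors above and below, and
  \<open>- order * ln y\<close> remains.\<close>

lemma gamma_quotient_ray_bound:
  assumes "\<phi> \<noteq> 0" "y0 > 0"
  shows "\<exists>C\<ge>0. \<forall>y\<ge>y0. norm (gamma_quotient (Complex (- y) \<phi>)) \<le> C * R powr (- y) * y powr (- order)"
proof -
  define g where "g = (\<lambda>A p y. ln (norm (Gamma (of_real A * Complex (- y) \<phi> + of_real p))))"
  define h where "h = (\<lambda>A p y. A * y - A * ln A * y - (A * y + 1/2 - p) * ln y :: real)"
  have "\<forall>k\<in>{1..n}. \<exists>C. \<forall>y\<ge>y0. \<bar>g (B k) (b k) y - h (B k) (b k) y\<bar> \<le> C"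
    unfolding g_def h_def using assms B_pos by (intro ballI Gamma_ray_bounds)
  then obtain CB where CB: "\<And>k y. k \<in> {1..n} \<Longrightarrow> y \<ge> y0 \<Longrightarrow> \<bar>g (B k) (b k) y - h (B k) (b k) y\<bar> \<le> CB k"
    by metis
  have "\<forall>k\<in>{1..n}. \<exists>C. \<forall>y\<ge>y0. \<bar>g (A k) (a k) y - h (A k) (a k) y\<bar> \<le> C"
    unfolding g_def h_def using assms A_pos by (intro ballI Gamma_ray_bounds)
  then obtain CA where CA: "\<And>k y. k \<in> {1..n} \<Longrightarrow> y \<ge> y0 \<Longrightarrow> \<bar>g (A k) (a k) y - h (A k) (a k) y\<bar> \<le> CA k"
    by metis
  define C where "C = (\<Sum>k=1..n. CA k + CB k)"
  have "norm (gamma_quotient (Complex (- y) \<phi>)) \<le> exp C * R powr (- y) * y powr (- order)" if y: "y \<ge> y0" for y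
  proof -
    have y_pos: "y > 0" using y assms by simp
    \<comment> \<open>Off the real axis no factor sits at a pole, where Gamma would have the value
      0; hence every norm is the exponential of its logarithm.\<close>
    have nz: "Gamma (of_real A * Complex (- y) \<phi> + of_real p) \<noteq> 0" if "A > 0" for A p
      using that assms Complex_notin_nonpos_Ints[of "A * \<phi>" "p - A * y"]
      by (simp add: Gamma_eq_zero_iff complex_of_real_def complex_mult complex_add algebra_simps)
    have "norm (gamma_quotient (Complex (- y) \<phi>)) = (\<Prod>k=1..n. exp (g (B k) (b k) y - g (A k) (a k) y))"
      unfolding gamma_quotient_def prod_norm[symmetric]
      by (intro prod.cong refl) (use nz A_pos B_pos in \<open>simp add: g_def exp_diff norm_divide\<close>)
    also have "\<dots> = exp (\<Sum>k=1..n. g (B k) (b k) y - g (A k) (a k) y)"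
      by (simp add: exp_sum)
    also have "\<dots> \<le> exp (C + (\<Sum>k=1..n. h (B k) (b k) y - h (A k) (a k) y))"
      unfolding C_def sum.distrib[symmetric] exp_le_cancel_iff
    proof (rule sum_mono)
      fix k assume k: "k \<in> {1..n}"
      show "g (B k) (b k) y - g (A k) (a k) y \<le> CA k + CB k + (h (B k) (b k) y - h (A k) (a k) y)"
        using CA[OF k y] CB[OF k y] by linarith
    qed
    also have "(\<Sum>k=1..n. h (B k) (b k) y - h (A k) (a k) y) = - y * ln R - order * ln y"
    proof -
      have "(\<Sum>k=1..n. h (B k) (b k) y) - (\<Sum>k=1..n. h (A k) (a k) y)
        = ((\<Sum>k=1..n. B k) - (\<Sum>k=1..n. A k)) * (y - y * ln y)
          - y * ((\<Sum>k=1..n. B k * ln (B k)) - (\<Sum>k=1..n. A k * ln (A k)))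
          - ((\<Sum>k=1..n. a k) - (\<Sum>k=1..n. b k)) * ln y"
        unfolding h_def
        by (simp add: sum.distrib sum_subtractf sum_distrib_left sum_distrib_right algebra_simps)
      then show ?thesis using balanced by (simp add: sum_subtractf ln_R order_def)
    qed
    also have "exp (C + (- y * ln R - order * ln y)) = exp C * R powr (- y) * y powr (- order)"
      using R_pos y_pos by (simp add: powr_def exp_add exp_diff exp_minus field_simps)
    finally show ?thesis .
  qed
  then show ?thesis by (intro exI[of _ "exp C"]) auto
qed

section \<open>Poles and holomorphy\<close>

lemma abscissa_neg: "abscissa < 0"
  using n_pos b_pos B_pos by (auto simp: abscissa_def)

lemma Re_gt_abscissa:
  assumes "Re s > abscissa" "k \<in> {1..n}"
  shows "of_real (B k) * s + of_real (b k) \<notin> \<int>\<^sub>\<le>\<^sub>0"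
proof -
  have "Min ((\<lambda>k. b k / B k) ` {1..n}) \<le> b k / B k"
    using assms by (intro Min_le) auto
  then have "- (b k / B k) < Re s" using assms by (simp add: abscissa_def)
  then have "Re (of_real (B k) * s + of_real (b k)) > 0"
    using B_pos[OF assms(2)] by (simp add: field_simps)
  then show ?thesis using complex_nonpos_IntsD by force
qed

lemma Im_nonzero_not_pole:
  assumes "Im s \<noteq> 0" "k \<in> {1..n}"
  shows "of_real (B k) * s + of_real (b k) \<notin> \<int>\<^sub>\<le>\<^sub>0"
proof -
  have "Im (of_real (B k) * s + of_real (b k)) \<noteq> 0"
    using B_pos[OF assms(2)] assms by simp
  then show ?thesis using complex_nonpos_IntsD by force
qed

lemma gamma_quotient_holomorphic:
  assumes "\<And>s k. s \<in> S \<Longrightarrow> k \<in> {1..n} \<Longrightarrow> of_real (B k) * s + of_real (b k) \<notin> \<int>\<^sub>\<le>\<^sub>0"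
  shows "gamma_quotient holomorphic_on S"
proof -
  \<comment> \<open>Written with \<open>rGamma\<close> the denominator is an entire factor, so only
    the numerator restricts the domain.\<close>
  have "(\<lambda>s. \<Prod>k=1..n. Gamma (of_real (B k) * s + of_real (b k)) * rGamma (of_real (A k) * s + of_real (a k)))
    holomorphic_on S"
    using assms by (intro holomorphic_intros) auto
  then show ?thesis
    by (simp add: gamma_quotient_def[abs_def] rGamma_inverse_Gamma field_simps)
qed

text \<open>For \<open>z = 1 / u\<close> with u > 0 the factor \<open>z powr (- s)\<close> is u^s.
  In exponential form it is entire in s, and its norm u^(Re s) depends on the real part
  alone.\<close>

definition integrand :: "real \<Rightarrow> complex \<Rightarrow> complex" where
  "integrand u s = gamma_quotient s * exp (s * of_real (ln u))"

definition kernel :: "real \<Rightarrow> real \<Rightarrow> real \<Rightarrow> real \<Rightarrow> complex" where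
  "kernel \<phi>1 \<phi>2 c u = fox_H \<phi>1 \<phi>2 c n (\<lambda>k. of_real (a k)) A (\<lambda>k. of_real (b k)) B (of_real (1 / u))"

lemma kernel_eq:
  assumes "u > 0"
  shows "kernel \<phi>1 \<phi>2 c u =
    (if 1 < u * R then 1 / (2 * of_real pi * \<i>) * left_loop_integral \<phi>1 \<phi>2 c (integrand u) else 0)"
proof -
  have "of_real (1 / u) powr (- s) = exp (s * of_real (ln u))" for s :: complex
  proof -
    have "Ln (complex_of_real (1 / u)) = of_real (- ln u)"
      using Ln_of_real[of "1 / u"] assms by (simp only: ln_div ln_one zero_less_divide_1_iff) simp
    moreover have "complex_of_real (1 / u) \<noteq> 0" using assms by simp
    ultimately show ?thesis by (simp only: powr_def if_False) simp
  qed
  then have "(\<lambda>s. (\<Prod>k=1..n. Gamma (of_real (B k) * s + of_real (b k)) / Gamma (of_real (A k) * s + of_real (a k)))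
      * of_real (1 / u) powr (- s)) = integrand u"
    by (simp add: integrand_def[abs_def] gamma_quotient_def)
  moreover have "0 < norm (complex_of_real (1 / u)) \<and> norm (complex_of_real (1 / u)) < R \<longleftrightarrow> 1 < u * R"
    unfolding norm_of_real using assms by (simp add: field_simps)
  ultimately show ?thesis by (simp add: kernel_def fox_H_def)
qed

lemma norm_exp_mult_ln:
  assumes "u > 0"
  shows "norm (exp (s * of_real (ln u))) = u powr Re s"
  using assms by (simp add: powr_def)

lemma integrand_ray_bound:
  assumes "\<phi> \<noteq> 0" "y0 > 0"
  shows "\<exists>C\<ge>0. \<forall>u>0. \<forall>y\<ge>y0. norm (integrand u (Complex (- y) \<phi>)) \<le> C * ((u * R) powr (- y) * y powr (- order))"
proof -
  obtain C where C: "C \<ge> 0" "\<And>y. y \<ge> y0 \<Longrightarrow> norm (gamma_quotient (Complex (- y) \<phi>)) \<le> C * R powr (- y) * y powr (- order)"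
    using gamma_quotient_ray_bound[OF assms] by blast
  have "norm (integrand u (Complex (- y) \<phi>)) \<le> C * ((u * R) powr (- y) * y powr (- order))"
    if "u > 0" "y \<ge> y0" for u y
  proof -
    have "norm (integrand u (Complex (- y) \<phi>)) = norm (gamma_quotient (Complex (- y) \<phi>)) * u powr (- y)"
      unfolding integrand_def norm_mult norm_exp_mult_ln[OF that(1)] by simp
    also have "\<dots> \<le> C * R powr (- y) * y powr (- order) * u powr (- y)"
      by (intro mult_right_mono C(2) that) simp
    also have "\<dots> = C * ((u * R) powr (- y) * y powr (- order))"
      using that R_pos by (simp add: powr_mult mult_ac)
    finally show ?thesis .
  qed
  with C(1) show ?thesis by blast
qed

lemma gamma_quotient_ray_measurable:
  assumes "\<phi> \<noteq> 0"
  shows "(\<lambda>x. gamma_quotient (Complex x \<phi>)) \<in> borel_measurable borel"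
proof -
  have "continuous_on {s. Im s \<noteq> 0} gamma_quotient"
    by (intro holomorphic_on_imp_continuous_on gamma_quotient_holomorphic) (use Im_nonzero_not_pole in blast)
  moreover have "continuous_on UNIV (\<lambda>x. Complex x \<phi>)"
    unfolding Complex_eq by (intro continuous_intros)
  moreover have "range (\<lambda>x. Complex x \<phi>) \<subseteq> {s. Im s \<noteq> 0}"
    using assms by auto
  ultimately have "continuous_on UNIV (\<lambda>x. gamma_quotient (Complex x \<phi>))"
    by (rule continuous_on_compose2)
  then show ?thesis by (rule borel_measurable_continuous_onI)
qed

lemma Complex_measurable: "(\<lambda>x. Complex x \<phi>) \<in> borel_measurable borel"
  unfolding Complex_eq by (intro borel_measurable_continuous_onI continuous_intros)

text \<open>Joint measurability is what makes the ray integrals measurable functions of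
  \<open>u\<close>.\<close>

lemma integrand_ray_measurable:
  assumes "\<phi> \<noteq> 0"
  shows "(\<lambda>(u, x). integrand u (Complex x \<phi>)) \<in> borel_measurable (borel \<Otimes>\<^sub>M borel)"
proof -
  note [measurable] = gamma_quotient_ray_measurable[OF assms] Complex_measurable
  show ?thesis unfolding integrand_def by measurable
qed

text \<open>Taken in the extended nonnegative reals, so that it can be estimated for every u > 0,
  even where the ray integral diverges.\<close>

definition ray_mass :: "real \<Rightarrow> real \<Rightarrow> real \<Rightarrow> ennreal" where
  "ray_mass \<phi> c u = (\<integral>\<^sup>+x\<in>{..c}. ennreal (norm (integrand u (Complex x \<phi>))) \<partial>lborel)"

text \<open>The constant is the same for all u, which allows the bound to be integrated over u.
  Since c < 0, the reflected ray stays in y \<ge> -c > 0, where the Stirling bound applies.\<close>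

lemma ray_mass_le:
  assumes "c < 0" "\<phi> \<noteq> 0"
  shows "\<exists>C\<ge>0. \<forall>u>0. ray_mass \<phi> c u
    \<le> ennreal C * (\<integral>\<^sup>+y\<in>{-c..}. ennreal ((u * R) powr (- y) * y powr (- order)) \<partial>lborel)"
proof -
  obtain C where C: "C \<ge> 0" "\<And>u y. u > 0 \<Longrightarrow> y \<ge> - c \<Longrightarrow>
      norm (integrand u (Complex (- y) \<phi>)) \<le> C * ((u * R) powr (- y) * y powr (- order))"
    using integrand_ray_bound[OF assms(2), of "- c"] assms by auto
  have "ray_mass \<phi> c u
    \<le> ennreal C * (\<integral>\<^sup>+y\<in>{-c..}. ennreal ((u * R) powr (- y) * y powr (- order)) \<partial>lborel)" if "u > 0" for u
  proof -
    have [measurable]: "(\<lambda>x. integrand u (Complex x \<phi>)) \<in> borel_measurable borel"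
      using measurable_compose[OF measurable_Pair1' integrand_ray_measurable[OF assms(2)], of u] by simp
    have "ray_mass \<phi> c u = (\<integral>\<^sup>+y. ennreal (norm (integrand u (Complex (- y) \<phi>))) * indicator {..c} (- y) \<partial>lborel)"
      unfolding ray_mass_def by (subst nn_integral_reflect) auto
    also have "\<dots> \<le> (\<integral>\<^sup>+y. ennreal C * (ennreal ((u * R) powr (- y) * y powr (- order)) * indicator {-c..} y) \<partial>lborel)"
      using C that
      by (intro nn_integral_mono) (auto split: split_indicator simp: ennreal_mult[symmetric])
    also have "\<dots> = ennreal C * (\<integral>\<^sup>+y\<in>{-c..}. ennreal ((u * R) powr (- y) * y powr (- order)) \<partial>lborel)"
      by (rule nn_integral_cmult) measurable
    finally show ?thesis .
  qed
  with C(1) show ?thesis by blast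
qed

lemma ray_set_integrable:
  assumes "c < 0" "\<phi> \<noteq> 0" "u > 0" "1 < u * R"
  shows "set_integrable lborel {..c} (\<lambda>x. integrand u (Complex x \<phi>))"
proof -
  have [measurable]: "(\<lambda>x. integrand u (Complex x \<phi>)) \<in> borel_measurable borel"
    using measurable_compose[OF measurable_Pair1' integrand_ray_measurable[OF assms(2)], of u] by simp
  obtain C where C: "ray_mass \<phi> c u
    \<le> ennreal C * (\<integral>\<^sup>+y\<in>{-c..}. ennreal ((u * R) powr (- y) * y powr (- order)) \<partial>lborel)"
    using ray_mass_le[OF assms(1,2)] assms(3) by blast
  \<comment> \<open>On y \<ge> -c the power of y is at most its value at -c, and (u R)^(-y) alone
    makes the integral finite because u R > 1.\<close>
  have "(\<integral>\<^sup>+y\<in>{-c..}. ennreal ((u * R) powr (- y) * y powr (- order)) \<partial>lborel)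
    \<le> (\<integral>\<^sup>+y. ennreal ((- c) powr (- order)) * (ennreal ((u * R) powr (- y)) * indicator {-c..} y) \<partial>lborel)"
    using assms order_gt_0
    by (intro nn_integral_mono)
       (auto split: split_indicator simp: ennreal_mult[symmetric] mult.commute
         intro!: ennreal_leI mult_right_mono powr_mono2')
  also have "\<dots> = ennreal ((- c) powr (- order)) * (\<integral>\<^sup>+y\<in>{-c..}. ennreal ((u * R) powr (- y)) \<partial>lborel)"
    by (rule nn_integral_cmult) measurable
  also have "\<dots> < \<infinity>"
    using nn_integral_exp_decay[OF assms(4), of "- c"] by (simp add: ennreal_mult_less_top)
  finally have "ray_mass \<phi> c u < \<infinity>"
    using C by (simp add: ennreal_mult_less_top le_less_trans)
  moreover have "(\<integral>\<^sup>+x. ennreal (norm (indicator {..c} x *\<^sub>R integrand u (Complex x \<phi>))) \<partial>lborel) = ray_mass \<phi> c u"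
    unfolding ray_mass_def by (intro nn_integral_cong) (auto split: split_indicator)
  ultimately show ?thesis
    unfolding set_integrable_def by (intro integrableI_bounded) auto
qed

section \<open>Moving the vertical side of the loop\<close>

lemma integrand_holomorphic: "integrand u holomorphic_on {s. Re s > abscissa}"
  unfolding integrand_def[abs_def] using Re_gt_abscissa
  by (intro holomorphic_intros gamma_quotient_holomorphic) auto

text \<open>Both vertical lines lie in a half-plane on which the integrand has a primitive.\<close>

lemma left_loop_integral_shift:
  assumes "abscissa < c'" "c' < 0" "c' \<le> c" "\<phi>1 \<noteq> 0" "\<phi>2 \<noteq> 0" "u > 0" "1 < u * R"
  shows "left_loop_integral \<phi>1 \<phi>2 c (integrand u) = left_loop_integral \<phi>1 \<phi>2 c' (integrand u)"
proof -
  let ?S = "{s. Re s > abscissa}" and ?f = "integrand u"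
  have S: "convex ?S" "open ?S"
    by (simp_all add: convex_halfspace_Re_gt open_halfspace_Re_gt)
  obtain P where "\<And>s. s \<in> ?S \<Longrightarrow> (P has_field_derivative ?f s) (at s within ?S)"
    using holomorphic_convex_primitive'[OF S integrand_holomorphic] by blast
  then have P: "(P has_field_derivative ?f s) (at s)" if "s \<in> ?S" for s
    using that at_within_open[OF that S(2)] by metis
  have cont: "continuous_on ?S ?f"
    by (rule holomorphic_on_imp_continuous_on[OF integrand_holomorphic])
  have vertical: "contour_integral (linepath (Complex x \<phi>1) (Complex x \<phi>2)) ?f
      = P (Complex x \<phi>2) - P (Complex x \<phi>1)" if "x > abscissa" for x
  proof -
    have "closed_segment (Complex x \<phi>1) (Complex x \<phi>2) \<subseteq> ?S"
      using that S(1) by (intro closed_segment_subset) auto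
    then have "(?f has_contour_integral P (pathfinish (linepath (Complex x \<phi>1) (Complex x \<phi>2)))
        - P (pathstart (linepath (Complex x \<phi>1) (Complex x \<phi>2)))) (linepath (Complex x \<phi>1) (Complex x \<phi>2))"
      by (intro contour_integral_primitive[where S = ?S]) (auto intro: has_field_derivative_at_within P)
    then show ?thesis by (simp add: contour_integral_unique)
  qed
  \<comment> \<open>Cutting the ray at c' splits off a piece inside the half-plane, where the
    integral is a difference of values of \<open>P\<close>.\<close>
  have horizontal: "(LBINT x:{..c}. ?f (Complex x \<phi>)) =
      (LBINT x:{..c'}. ?f (Complex x \<phi>)) + (P (Complex c \<phi>) - P (Complex c' \<phi>))" if "\<phi> \<noteq> 0" for \<phi>
  proof -
    have c: "continuous_on {c'..c} (\<lambda>x. ?f (Complex x \<phi>))"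
    proof (rule continuous_on_compose2[OF cont])
      show "continuous_on {c'..c} (\<lambda>x. Complex x \<phi>)"
        unfolding Complex_eq by (intro continuous_intros)
    qed (use assms in auto)
    have "{..c} = {..c'} \<union> {c'..c}" using assms by auto
    moreover have "(LBINT x:{..c'} \<union> {c'..c}. ?f (Complex x \<phi>))
        = (LBINT x:{..c'}. ?f (Complex x \<phi>)) + (LBINT x:{c'..c}. ?f (Complex x \<phi>))"
    proof (rule set_integral_Un_AE)
      show "AE x in lborel. \<not> (x \<in> {..c'} \<and> x \<in> {c'..c})"
        using AE_lborel_singleton[of c'] by eventually_elim auto
      show "set_integrable lborel {..c'} (\<lambda>x. ?f (Complex x \<phi>))"
        using ray_set_integrable assms that by blast
      show "set_integrable lborel {c'..c} (\<lambda>x. ?f (Complex x \<phi>))"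
        by (rule borel_integrable_atLeastAtMost'[OF c])
    qed auto
    moreover have "(LBINT x:{c'..c}. ?f (Complex x \<phi>)) = P (Complex c \<phi>) - P (Complex c' \<phi>)"
      unfolding set_lebesgue_integral_def
    proof (rule integral_FTC_atLeastAtMost[OF assms(3) _ c])
      fix x assume x: "c' \<le> x" "x \<le> c"
      have "((\<lambda>x. Complex x \<phi>) has_vector_derivative 1) (at x within {c'..c})"
        unfolding Complex_eq by (auto intro!: derivative_eq_intros has_vector_derivative_of_real)
      moreover have "(P has_field_derivative ?f (Complex x \<phi>)) (at (Complex x \<phi>) within (\<lambda>x. Complex x \<phi>) ` {c'..c})"
        by (rule has_field_derivative_at_within[OF P]) (use x assms in auto)
      ultimately show "((\<lambda>x. P (Complex x \<phi>)) has_vector_derivative ?f (Complex x \<phi>)) (at x within {c'..c})"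
        using field_vector_diff_chain_within[of "\<lambda>x. Complex x \<phi>" 1 x "{c'..c}" P] by (simp add: o_def)
    qed
    ultimately show ?thesis by simp
  qed
  \<comment> \<open>The values of \<open>P\<close> at the two corners with real part c cancel; those
    at the corners with real part c' make up the vertical side of the new loop.\<close>
  show ?thesis
    unfolding left_loop_integral_def using assms by (simp add: vertical horizontal)
qed

lemma set_integral_norm_le_ray_mass:
  assumes "c < 0" "\<phi> \<noteq> 0" "u > 0" "1 < u * R"
  shows "ennreal (norm (LBINT x:{..c}. integrand u (Complex x \<phi>))) \<le> ray_mass \<phi> c u"
proof -
  have "ennreal (norm (LBINT x:{..c}. integrand u (Complex x \<phi>)))
    \<le> (\<integral>\<^sup>+x. ennreal (norm (indicator {..c} x *\<^sub>R integrand u (Complex x \<phi>))) \<partial>lborel)"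
    using ray_set_integrable[OF assms] unfolding set_lebesgue_integral_def set_integrable_def
    by (rule integral_norm_bound_ennreal)
  also have "\<dots> = ray_mass \<phi> c u"
    unfolding ray_mass_def by (intro nn_integral_cong) (auto split: split_indicator)
  finally show ?thesis .
qed

text \<open>On the vertical side |u^s| = u^c, and the Gamma quotient is bounded on the compact
  segment by a constant independent of u.\<close>

lemma vertical_bound:
  assumes "abscissa < c"
  shows "\<exists>M\<ge>0. \<forall>u>0. norm (contour_integral (linepath (Complex c \<phi>1) (Complex c \<phi>2)) (integrand u)) \<le> M * u powr c"
proof -
  let ?L = "closed_segment (Complex c \<phi>1) (Complex c \<phi>2)"
  have L: "Re s = c" if "s \<in> ?L" for s
    using that closed_segment_same_Re[of "Complex c \<phi>1" "Complex c \<phi>2"] by auto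
  then have L': "?L \<subseteq> {s. Re s > abscissa}" using assms by auto
  have "continuous_on ?L gamma_quotient"
    using Re_gt_abscissa L' by (intro holomorphic_on_imp_continuous_on gamma_quotient_holomorphic) auto
  then have "compact (gamma_quotient ` ?L)"
    by (intro compact_continuous_image) auto
  then have "bounded (gamma_quotient ` ?L)"
    by (rule compact_imp_bounded)
  then obtain M where M: "M > 0" "\<forall>s\<in>?L. norm (gamma_quotient s) \<le> M"
    by (auto simp: bounded_pos)
  have "norm (contour_integral (linepath (Complex c \<phi>1) (Complex c \<phi>2)) (integrand u))
      \<le> (M * u powr c) * norm (Complex c \<phi>2 - Complex c \<phi>1)" if "u > 0" for u
  proof (rule contour_integral_bound_linepath)
    show "integrand u contour_integrable_on linepath (Complex c \<phi>1) (Complex c \<phi>2)"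
      using integrand_holomorphic L'
      by (intro contour_integrable_continuous_linepath holomorphic_on_imp_continuous_on)
         (rule holomorphic_on_subset)
    show "norm (integrand u s) \<le> M * u powr c" if "s \<in> ?L" for s
      unfolding integrand_def norm_mult norm_exp_mult_ln[OF \<open>u > 0\<close>] L[OF that]
      using M that by (intro mult_right_mono) auto
  qed (use M in simp)
  then show ?thesis
    using M by (intro exI[of _ "M * norm (Complex c \<phi>2 - Complex c \<phi>1)"]) (simp add: mult_ac)
qed

section \<open>Finiteness of the constant\<close>

lemma ray_mass_mellin_finite:
  assumes "y0 > 0"
  shows "(\<integral>\<^sup>+u\<in>{1/R..}. (\<integral>\<^sup>+y\<in>{y0..}. ennreal ((u * R) powr (- y) * y powr (- order)) \<partial>lborel) * ennreal (1 / u) \<partial>lborel) < \<infinity>"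
proof -
  have R: "R > 0" "R \<noteq> 0" using R_pos by auto
  have "(\<integral>\<^sup>+u\<in>{1/R..}. (\<integral>\<^sup>+y\<in>{y0..}. ennreal ((u * R) powr (- y) * y powr (- order)) \<partial>lborel) * ennreal (1 / u) \<partial>lborel)
    = (\<integral>\<^sup>+u. (\<integral>\<^sup>+y. ennreal ((u * R) powr (- y) * y powr (- order)) * indicator {y0..} y * (ennreal (1 / u) * indicator {1/R..} u) \<partial>lborel) \<partial>lborel)"
    by (subst nn_integral_multc) (auto simp: mult.assoc)
  \<comment> \<open>For \<open>order \<le> 1\<close> the integral over y diverges at u = 1/R;
    carrying out the integral over u first avoids this point.\<close>
  also have "\<dots> = (\<integral>\<^sup>+y. (\<integral>\<^sup>+u. ennreal ((u * R) powr (- y) * y powr (- order)) * indicator {y0..} y * (ennreal (1 / u) * indicator {1/R..} u) \<partial>lborel) \<partial>lborel)"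
    by (rule lborel_pair.Fubini') measurable
  also have "\<dots> = (\<integral>\<^sup>+y\<in>{y0..}. ennreal (y powr (- order - 1)) \<partial>lborel)"
  proof (rule nn_integral_cong)
    fix y :: real
    show "(\<integral>\<^sup>+u. ennreal ((u * R) powr (- y) * y powr (- order)) * indicator {y0..} y * (ennreal (1 / u) * indicator {1/R..} u) \<partial>lborel)
      = ennreal (y powr (- order - 1)) * indicator {y0..} y"
    proof (cases "y \<ge> y0")
      case True
      then have y: "y > 0" using assms by simp
      have "(\<integral>\<^sup>+u. ennreal ((u * R) powr (- y) * y powr (- order)) * indicator {y0..} y * (ennreal (1 / u) * indicator {1/R..} u) \<partial>lborel)
        = (\<integral>\<^sup>+u. ennreal (R powr (- y) * y powr (- order)) * (ennreal (u powr (- y - 1)) * indicator {1/R..} u) \<partial>lborel)"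
      proof (rule nn_integral_cong)
        fix u :: real
        have "(u * R) powr (- y) * y powr (- order) * (1 / u) = R powr (- y) * y powr (- order) * u powr (- y - 1)"
          if "u \<ge> 1/R"
        proof -
          have "u > 0" using that R by (smt (verit) divide_pos_pos)
          then show ?thesis using R by (simp add: powr_mult powr_diff)
        qed
        then show "ennreal ((u * R) powr (- y) * y powr (- order)) * indicator {y0..} y * (ennreal (1 / u) * indicator {1/R..} u)
          = ennreal (R powr (- y) * y powr (- order)) * (ennreal (u powr (- y - 1)) * indicator {1/R..} u)"
          using True by (auto split: split_indicator simp: ennreal_mult'[symmetric])
      qed
      also have "\<dots> = ennreal (R powr (- y) * y powr (- order)) * ennreal ((1/R) powr (- y) / y)"
        using nn_integral_powr_atLeast[of "1/R" "- y"] R y by (subst nn_integral_cmult) auto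
      also have "\<dots> = ennreal (y powr (- order - 1))"
        using R y by (simp add: ennreal_mult'[symmetric] powr_divide powr_minus powr_diff field_simps)
      finally show ?thesis using True by simp
    qed auto
  qed
  also have "\<dots> < \<infinity>"
    using nn_integral_powr_atLeast[of y0 "- order"] order_gt_0 assms by simp
  finally show ?thesis .
qed

lemma kernel_mass_finite:
  assumes "abscissa < c" "\<phi>1 \<noteq> 0" "\<phi>2 \<noteq> 0"
  shows "(\<integral>\<^sup>+u\<in>{1..}. ennreal (norm (kernel \<phi>1 \<phi>2 c u) / u) \<partial>lborel) < \<infinity>"
proof -
  \<comment> \<open>The midpoint between the rightmost pole and min(c, 0): to the right of all
    poles, negative, and not beyond c.\<close>
  define c' where "c' = (abscissa + min c 0) / 2"
  have c': "abscissa < c'" "c' < 0" "c' \<le> c"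
    using assms(1) abscissa_neg by (auto simp: c'_def min_def field_simps)
  define W where "W = (\<lambda>u. \<integral>\<^sup>+y\<in>{-c'..}. ennreal ((u * R) powr (- y) * y powr (- order)) \<partial>lborel)"
  have [measurable]: "W \<in> borel_measurable borel"
    unfolding W_def by measurable
  obtain C1 where C1: "C1 \<ge> 0" "\<And>u. u > 0 \<Longrightarrow> ray_mass \<phi>1 c' u \<le> ennreal C1 * W u"
    using ray_mass_le[OF c'(2) assms(2)] unfolding W_def by blast
  obtain C2 where C2: "C2 \<ge> 0" "\<And>u. u > 0 \<Longrightarrow> ray_mass \<phi>2 c' u \<le> ennreal C2 * W u"
    using ray_mass_le[OF c'(2) assms(3)] unfolding W_def by blast
  obtain M where M: "M \<ge> 0" "\<And>u. u > 0 \<Longrightarrow>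
      norm (contour_integral (linepath (Complex c' \<phi>1) (Complex c' \<phi>2)) (integrand u)) \<le> M * u powr c'"
    using vertical_bound[OF c'(1)] by blast
  have bound: "ennreal (norm (kernel \<phi>1 \<phi>2 c u)) \<le> ennreal (C1 + C2) * W u + ennreal (M * u powr c')"
    if "u > 0" "1 < u * R" for u
  proof -
    have "norm (kernel \<phi>1 \<phi>2 c u) = 1 / (2 * pi) * norm (left_loop_integral \<phi>1 \<phi>2 c' (integrand u))"
      using that c' assms by (simp add: kernel_eq left_loop_integral_shift[of c' c] norm_mult norm_divide)
    also have "\<dots> \<le> 1 * norm (left_loop_integral \<phi>1 \<phi>2 c' (integrand u))"
      using pi_gt3 by (intro mult_right_mono) (auto simp: field_simps)
    also have "\<dots> \<le> norm (LBINT x:{..c'}. integrand u (Complex x \<phi>1))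
       + norm (contour_integral (linepath (Complex c' \<phi>1) (Complex c' \<phi>2)) (integrand u))
       + norm (LBINT x:{..c'}. integrand u (Complex x \<phi>2))"
      unfolding left_loop_integral_def mult_1
      by (intro order_trans[OF norm_triangle_ineq4] add_right_mono norm_triangle_ineq)
    finally have "ennreal (norm (kernel \<phi>1 \<phi>2 c u)) \<le> ennreal (norm (LBINT x:{..c'}. integrand u (Complex x \<phi>1)))
       + ennreal (norm (contour_integral (linepath (Complex c' \<phi>1) (Complex c' \<phi>2)) (integrand u)))
       + ennreal (norm (LBINT x:{..c'}. integrand u (Complex x \<phi>2)))"
      by (simp add: ennreal_plus[symmetric] del: ennreal_plus)
    also have "\<dots> \<le> ennreal C1 * W u + ennreal (M * u powr c') + ennreal C2 * W u"
      using that c' assms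
      by (intro add_mono ennreal_leI M(2) order_trans[OF set_integral_norm_le_ray_mass C1(2)]
          order_trans[OF set_integral_norm_le_ray_mass C2(2)]) auto
    also have "\<dots> = ennreal (C1 + C2) * W u + ennreal (M * u powr c')"
      using C1 C2 by (simp add: ennreal_plus distrib_right add_ac)
    finally show ?thesis .
  qed
  \<comment> \<open>The left integrand is nonzero only if u \<ge> 1 and u R > 1, hence u \<ge> 1/R.
    The majorant is integrated over the whole range that starts at the singularity.\<close>
  have "(\<integral>\<^sup>+u\<in>{1..}. ennreal (norm (kernel \<phi>1 \<phi>2 c u) / u) \<partial>lborel)
    \<le> (\<integral>\<^sup>+u. ennreal (C1 + C2) * (W u * ennreal (1 / u) * indicator {1/R..} u)
         + ennreal M * (ennreal (u powr (c' - 1)) * indicator {1/R..} u) \<partial>lborel)"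
  proof (rule nn_integral_mono)
    fix u :: real
    show "ennreal (norm (kernel \<phi>1 \<phi>2 c u) / u) * indicator {1..} u
      \<le> ennreal (C1 + C2) * (W u * ennreal (1 / u) * indicator {1/R..} u)
         + ennreal M * (ennreal (u powr (c' - 1)) * indicator {1/R..} u)"
    proof (cases "u \<ge> 1 \<and> 1 < u * R")
      case True
      then have u: "u > 0" "1 < u * R" "u \<ge> 1/R" "u \<ge> 1" using R_pos by (auto simp: field_simps)
      have "ennreal (norm (kernel \<phi>1 \<phi>2 c u) / u) = ennreal (norm (kernel \<phi>1 \<phi>2 c u)) * ennreal (1 / u)"
        using u by (simp add: ennreal_mult'[symmetric])
      also have "\<dots> \<le> (ennreal (C1 + C2) * W u + ennreal (M * u powr c')) * ennreal (1 / u)"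
        by (intro mult_right_mono bound u) simp
      also have "ennreal (M * u powr c') * ennreal (1 / u) = ennreal M * ennreal (u powr (c' - 1))"
        using u M by (simp add: ennreal_mult'[symmetric] powr_diff)
      then have "(ennreal (C1 + C2) * W u + ennreal (M * u powr c')) * ennreal (1 / u)
        = ennreal (C1 + C2) * (W u * ennreal (1 / u)) + ennreal M * ennreal (u powr (c' - 1))"
        by (simp add: distrib_right mult.assoc)
      finally show ?thesis using u by simp
    next
      case False
      then show ?thesis by (auto simp: kernel_eq split: split_indicator)
    qed
  qed
  also have "\<dots> = ennreal (C1 + C2) * (\<integral>\<^sup>+u\<in>{1/R..}. W u * ennreal (1 / u) \<partial>lborel)
         + ennreal M * (\<integral>\<^sup>+u\<in>{1/R..}. ennreal (u powr (c' - 1)) \<partial>lborel)"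
    by (subst nn_integral_add) (auto simp: nn_integral_cmult)
  also have "\<dots> < \<infinity>"
    using ray_mass_mellin_finite[of "- c'"] nn_integral_powr_atLeast[of "1/R" c'] c' R_pos
    by (simp add: ennreal_mult_less_top W_def)
  finally show ?thesis .
qed

text \<open>All sides of the loop are Lebesgue integrals of functions jointly measurable in u and
  the parameter; the vertical side is first pulled back to \<open>{0..1}\<close> along its
  parametrization. The indicator keeps u positive, as \<open>kernel_eq\<close> requires.\<close>

lemma kernel_measurable:
  assumes "abscissa < c" "\<phi>1 \<noteq> 0" "\<phi>2 \<noteq> 0"
  shows "(\<lambda>u. indicator {1..} u *\<^sub>R kernel \<phi>1 \<phi>2 c u) \<in> borel_measurable borel"
proof -
  have ray [measurable]: "(\<lambda>u. LBINT x:{..c}. integrand u (Complex x \<phi>)) \<in> borel_measurable borel"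
    if "\<phi> \<noteq> 0" for \<phi>
  proof -
    note [measurable] = integrand_ray_measurable[OF that]
    show ?thesis unfolding set_lebesgue_integral_def by measurable
  qed
  define p where "p = Complex c \<phi>1"
  define q where "q = Complex c \<phi>2"
  have seg: "closed_segment p q \<subseteq> {s. Re s > abscissa}"
    using assms closed_segment_same_Re[of p q] by (auto simp: p_def q_def)
  have "continuous_on {s. Re s > abscissa} gamma_quotient"
    using Re_gt_abscissa by (intro holomorphic_on_imp_continuous_on gamma_quotient_holomorphic) auto
  moreover have "linepath p q ` {0..1} \<subseteq> {s. Re s > abscissa}"
    using seg by (simp add: linepath_image_01)
  ultimately have gc: "continuous_on {0..1} (\<lambda>t. gamma_quotient (linepath p q t))"
    by (rule continuous_on_compose2[of "{s. Re s > abscissa}" gamma_quotient, OF _ continuous_on_linepath])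
  then have [measurable]: "(\<lambda>t. indicator {0..1} t *\<^sub>R gamma_quotient (linepath p q t)) \<in> borel_measurable borel"
    by (intro borel_measurable_continuous_on_indicator) auto
  have [measurable]: "linepath p q \<in> borel_measurable borel"
    by (intro borel_measurable_continuous_onI continuous_on_linepath)
  have vertical: "contour_integral (linepath p q) (integrand u) =
    (LBINT t. (indicator {0..1} t *\<^sub>R gamma_quotient (linepath p q t)) * exp (linepath p q t * of_real (ln u)) * (q - p))" for u
  proof -
    have "set_integrable lborel {0..1} (\<lambda>t. integrand u (linepath p q t) * (q - p))"
      unfolding integrand_def
      by (intro borel_integrable_atLeastAtMost' continuous_intros gc continuous_on_linepath)
    from set_borel_integral_eq_integral(2)[OF this] show ?thesis
      unfolding contour_integral_integral
      by (simp add: set_lebesgue_integral_def integrand_def mult.assoc)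
  qed
  have [measurable]: "(\<lambda>u. contour_integral (linepath p q) (integrand u)) \<in> borel_measurable borel"
    unfolding vertical by measurable
  have "(\<lambda>u. left_loop_integral \<phi>1 \<phi>2 c (integrand u)) \<in> borel_measurable borel"
    unfolding left_loop_integral_def p_def[symmetric] q_def[symmetric]
    by (intro borel_measurable_add borel_measurable_diff ray assms) measurable
  then have *: "(\<lambda>u. if 1 \<le> u \<and> 1 < u * R then 1 / (2 * of_real pi * \<i>) * left_loop_integral \<phi>1 \<phi>2 c (integrand u) else 0)
    \<in> borel_measurable borel"
    by measurable
  have "(\<lambda>u. if 1 \<le> u \<and> 1 < u * R then 1 / (2 * of_real pi * \<i>) * left_loop_integral \<phi>1 \<phi>2 c (integrand u) else 0)
    = (\<lambda>u. indicator {1..} u *\<^sub>R kernel \<phi>1 \<phi>2 c u)"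
    by (auto simp: fun_eq_iff kernel_eq split: split_indicator)
  with * show ?thesis by (simp only:)
qed

end

section \<open>Schwartz functions and regular distributions\<close>

lemma power_mult_exp_minus_le_fact:
  fixes z :: real
  assumes "z \<ge> 0"
  shows "z ^ i * exp (- z) \<le> fact i"
proof -
  have "z ^ i /\<^sub>R fact i = (\<Sum>k\<in>{i}. z ^ k /\<^sub>R fact k)" by simp
  also have "\<dots> \<le> exp z"
    unfolding exp_def using assms by (intro sum_le_suminf summable_exp_generic) auto
  finally show ?thesis by (simp add: exp_minus field_simps)
qed

lemma power_mult_gaussian_bounded:
  fixes m x :: real
  assumes "m > 0"
  shows "\<exists>C. \<forall>y. \<bar>y ^ i * std_normal_density (m * (y - x))\<bar> \<le> C"
proof -
  have "\<bar>y ^ i * std_normal_density (m * (y - x))\<bar> \<le> fact i * exp (\<bar>x\<bar> + 1 / m\<^sup>2)" for y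
  proof -
    have "\<bar>y\<bar> \<le> \<bar>x\<bar> + \<bar>y - x\<bar>" by simp
    also have "\<bar>y - x\<bar> \<le> 1 / m\<^sup>2 + (m * (y - x))\<^sup>2 / 2"
    proof -
      \<comment> \<open>The shift 1/m makes the cross term exactly 2 |y - x|. The resulting
        inequality bounds the Gaussian by a constant times e^(-|y|).\<close>
      have "0 \<le> (m * \<bar>y - x\<bar> - 1 / m)\<^sup>2" by simp
      also have "\<dots> = (m * (y - x))\<^sup>2 - 2 * \<bar>y - x\<bar> + 1 / m\<^sup>2"
        using assms by (simp add: power2_diff power_mult_distrib power_one_over)
      finally have "2 * \<bar>y - x\<bar> \<le> (m * (y - x))\<^sup>2 + 1 / m\<^sup>2" by simp
      moreover have "a \<le> w + s / 2" if "2 * a \<le> s + w" "0 \<le> w" for a s w :: real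
        using that by linarith
      ultimately show ?thesis by (smt (verit) zero_le_divide_1_iff zero_le_power2)
    qed
    finally have "- (m * (y - x))\<^sup>2 / 2 \<le> - \<bar>y\<bar> + (\<bar>x\<bar> + 1 / m\<^sup>2)" by simp
    then have "exp (- (m * (y - x))\<^sup>2 / 2) \<le> exp (- \<bar>y\<bar>) * exp (\<bar>x\<bar> + 1 / m\<^sup>2)"
      unfolding exp_add[symmetric] by simp
    moreover have "std_normal_density (m * (y - x)) \<le> 1 * exp (- (m * (y - x))\<^sup>2 / 2)"
      unfolding std_normal_density_def using pi_gt3 by (intro mult_right_mono) auto
    ultimately have "std_normal_density (m * (y - x)) \<le> exp (- \<bar>y\<bar>) * exp (\<bar>x\<bar> + 1 / m\<^sup>2)"
      by simp
    then have "\<bar>y\<bar> ^ i * std_normal_density (m * (y - x)) \<le> \<bar>y\<bar> ^ i * (exp (- \<bar>y\<bar>) * exp (\<bar>x\<bar> + 1 / m\<^sup>2))"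
      by (intro mult_left_mono) auto
    also have "\<dots> = (\<bar>y\<bar> ^ i * exp (- \<bar>y\<bar>)) * exp (\<bar>x\<bar> + 1 / m\<^sup>2)" by simp
    also have "\<dots> \<le> fact i * exp (\<bar>x\<bar> + 1 / m\<^sup>2)"
      by (intro mult_right_mono power_mult_exp_minus_le_fact) auto
    finally show ?thesis by (simp add: abs_mult power_abs)
  qed
  then show ?thesis by blast
qed

text \<open>Splitting off the constant coefficient leaves y times a polynomial of lower degree, and
  this factor y is moved into y^i; hence i is arbitrary in the induction.\<close>

lemma poly_mult_gaussian_bounded:
  fixes m x :: real
  assumes "m > 0"
  shows "\<exists>C. \<forall>y. \<bar>y ^ i * (poly p y * std_normal_density (m * (y - x)))\<bar> \<le> C"
proof (induction p arbitrary: i)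
  case (pCons a p)
  obtain C where C: "\<And>y. \<bar>y ^ i * std_normal_density (m * (y - x))\<bar> \<le> C"
    using power_mult_gaussian_bounded[OF assms] by blast
  obtain D where D: "\<And>y. \<bar>y ^ Suc i * (poly p y * std_normal_density (m * (y - x)))\<bar> \<le> D"
    using pCons.IH by blast
  have "\<bar>y ^ i * (poly (pCons a p) y * std_normal_density (m * (y - x)))\<bar> \<le> \<bar>a\<bar> * C + D" for y
  proof -
    have "y ^ i * (poly (pCons a p) y * std_normal_density (m * (y - x)))
      = a * (y ^ i * std_normal_density (m * (y - x))) + y ^ Suc i * (poly p y * std_normal_density (m * (y - x)))"
      by (simp add: algebra_simps)
    moreover have "\<bar>a * (y ^ i * std_normal_density (m * (y - x)))\<bar> \<le> \<bar>a\<bar> * C"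
      unfolding abs_mult[of a] by (intro mult_left_mono C) simp
    ultimately show ?thesis using D[of y] by linarith
  qed
  then show ?case by blast
qed auto

text \<open>Differentiation keeps the form "polynomial times the same Gaussian". With the new
  polynomial explicit, the shape of all higher derivatives follows by induction.\<close>

lemma gaussian_poly_has_derivative:
  fixes m x y :: real
  shows "((\<lambda>y. poly p y * std_normal_density (m * (y - x))) has_real_derivative
     poly (pderiv p - smult (m\<^sup>2) ([:- x, 1:] * p)) y * std_normal_density (m * (y - x))) (at y)"
proof -
  have density: "(std_normal_density has_real_derivative - z * std_normal_density z) (at z)" for z
  proof -
    have "((\<lambda>z. c * exp (- z\<^sup>2 / 2)) has_real_derivative - z * (c * exp (- z\<^sup>2 / 2))) (at z)" for c
      by (auto intro!: derivative_eq_intros)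
    then show ?thesis unfolding std_normal_density_def[abs_def] .
  qed
  have "((\<lambda>y. std_normal_density (m * (y - x))) has_real_derivative
      - (m * (y - x)) * std_normal_density (m * (y - x)) * m) (at y)"
    by (rule DERIV_chain2[OF density]) (auto intro!: derivative_eq_intros)
  from DERIV_mult[OF poly_DERIV this] show ?thesis
    by (simp add: algebra_simps power2_eq_square)
qed

lemma gaussian_poly_has_vector_derivative:
  fixes m x y :: real
  shows "((\<lambda>y. complex_of_real (poly p y * std_normal_density (m * (y - x)))) has_vector_derivative
     complex_of_real (poly (pderiv p - smult (m\<^sup>2) ([:- x, 1:] * p)) y * std_normal_density (m * (y - x)))) (at y)"
  by (intro has_vector_derivative_of_real) (rule gaussian_poly_has_derivative)

lemma nth_deriv_gaussian:
  fixes m x :: real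
  shows "\<exists>p. nth_deriv k (\<lambda>y. complex_of_real (std_normal_density (m * (y - x)))) =
    (\<lambda>y. complex_of_real (poly p y * std_normal_density (m * (y - x))))"
proof (induction k)
  case 0
  show ?case by (intro exI[of _ 1]) (simp add: nth_deriv_def)
next
  case (Suc k)
  then obtain p where p: "nth_deriv k (\<lambda>y. complex_of_real (std_normal_density (m * (y - x)))) =
    (\<lambda>y. complex_of_real (poly p y * std_normal_density (m * (y - x))))" by blast
  have "nth_deriv (Suc k) (\<lambda>y. complex_of_real (std_normal_density (m * (y - x)))) =
    (\<lambda>y. vector_derivative (\<lambda>y. complex_of_real (poly p y * std_normal_density (m * (y - x)))) (at y))"
    using p by (simp add: nth_deriv_def)
  also have "\<dots> = (\<lambda>y. complex_of_real (poly (pderiv p - smult (m\<^sup>2) ([:- x, 1:] * p)) y * std_normal_density (m * (y - x))))"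
    by (intro ext vector_derivative_at gaussian_poly_has_vector_derivative)
  finally show ?case by blast
qed

lemma gaussian_schwartz:
  fixes m x :: real
  assumes "m > 0"
  shows "(\<lambda>y. complex_of_real (std_normal_density (m * (y - x)))) \<in> schwartz"
  unfolding schwartz_def mem_Collect_eq
proof (intro conjI allI)
  fix k y
  obtain p where p: "nth_deriv k (\<lambda>y. complex_of_real (std_normal_density (m * (y - x)))) =
    (\<lambda>y. complex_of_real (poly p y * std_normal_density (m * (y - x))))"
    using nth_deriv_gaussian by blast
  show "nth_deriv k (\<lambda>y. complex_of_real (std_normal_density (m * (y - x)))) differentiable at y"
    unfolding p by (rule differentiableI_vector[OF gaussian_poly_has_vector_derivative])
next
  fix i k
  obtain p where p: "nth_deriv k (\<lambda>y. complex_of_real (std_normal_density (m * (y - x)))) =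
    (\<lambda>y. complex_of_real (poly p y * std_normal_density (m * (y - x))))"
    using nth_deriv_gaussian by blast
  obtain C where "\<And>y. \<bar>y ^ i * (poly p y * std_normal_density (m * (y - x)))\<bar> \<le> C"
    using poly_mult_gaussian_bounded[OF assms] by blast
  then have "norm (y ^ i *\<^sub>R complex_of_real (poly p y * std_normal_density (m * (y - x)))) \<le> C" for y
    unfolding norm_scaleR norm_of_real abs_mult[symmetric] .
  then show "bounded (range (\<lambda>y. y ^ i *\<^sub>R nth_deriv k (\<lambda>y. complex_of_real (std_normal_density (m * (y - x)))) y))"
    unfolding p bounded_iff by blast
qed

text \<open>The substitution y = x + v / (j + 1) turns the left side into an average of g near x
  against a fixed density of mass 1. As g is bounded, dominated convergence applies.
  \<open>Suc j\<close> keeps the dilation positive.\<close>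

lemma gaussian_approximate_identity:
  fixes g :: "real \<Rightarrow> complex"
  assumes cont: "continuous_on UNIV g" and bdd: "bounded (range g)"
  shows "(\<lambda>j. real (Suc j) *\<^sub>R (LBINT y. g y * complex_of_real (std_normal_density (real (Suc j) * (y - x))))) \<longlonglongrightarrow> g x"
proof -
  obtain C where C: "\<And>y. norm (g y) \<le> C" using bdd by (auto simp: bounded_iff)
  have [measurable]: "g \<in> borel_measurable borel"
    by (rule borel_measurable_continuous_onI[OF cont])
  have density: "integrable lborel std_normal_density" "(LBINT v. std_normal_density v) = 1"
    using integrable_normal_density[of 1 0] integral_normal_density[of 1 0] by simp_all
  have "real (Suc j) *\<^sub>R (LBINT y. g y * complex_of_real (std_normal_density (real (Suc j) * (y - x))))
      = (LBINT v. g (x + v / real (Suc j)) * complex_of_real (std_normal_density v))" for j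
  proof -
    have "(LBINT y. g y * complex_of_real (std_normal_density (real (Suc j) * (y - x))))
      = \<bar>1 / real (Suc j)\<bar> *\<^sub>R (LBINT v. g (x + 1 / real (Suc j) * v) *
          complex_of_real (std_normal_density (real (Suc j) * (x + 1 / real (Suc j) * v - x))))"
      by (rule lborel_integral_real_affine) simp
    then show ?thesis by simp
  qed
  moreover have "(\<lambda>j. LBINT v. g (x + v / real (Suc j)) * complex_of_real (std_normal_density v))
      \<longlonglongrightarrow> (LBINT v. g x * complex_of_real (std_normal_density v))"
  proof (rule integral_dominated_convergence)
    show "integrable lborel (\<lambda>v. C * std_normal_density v)"
      using density by simp
    show "AE v in lborel. (\<lambda>j. g (x + v / real (Suc j)) * complex_of_real (std_normal_density v))
        \<longlonglongrightarrow> g x * complex_of_real (std_normal_density v)"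
    proof (intro AE_I2 tendsto_mult tendsto_const)
      fix v :: real
      have "(\<lambda>j. x + v / real (Suc j)) \<longlonglongrightarrow> x + 0"
        by (intro tendsto_add tendsto_const LIMSEQ_Suc lim_const_over_n)
      moreover have "isCont g x"
        using cont by (simp add: continuous_on_eq_continuous_at)
      ultimately show "(\<lambda>j. g (x + v / real (Suc j))) \<longlonglongrightarrow> g x"
        using isCont_tendsto_compose[of x g] by simp
    qed
    show "AE v in lborel. norm (g (x + v / real (Suc j)) * complex_of_real (std_normal_density v)) \<le> C * std_normal_density v" for j
      using C by (auto simp: norm_mult intro!: AE_I2 mult_right_mono)
  qed measurable
  moreover have "(LBINT v. g x * complex_of_real (std_normal_density v)) = g x"
    using density by (simp add: integral_complex_of_real)
  ultimately show ?thesis by simp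
qed

text \<open>The uniqueness on which the definite description in \<open>poisson_conv\<close> rests:
  Gaussians centred at x recover the value at x.\<close>

lemma schwartz_pairing_unique:
  fixes g h :: "real \<Rightarrow> complex"
  assumes "continuous_on UNIV g" "bounded (range g)" "continuous_on UNIV h" "bounded (range h)"
    and eq: "\<And>\<phi>. \<phi> \<in> schwartz \<Longrightarrow> (LBINT x. g x * \<phi> x) = (LBINT x. h x * \<phi> x)"
  shows "g = h"
proof
  fix x
  show "g x = h x"
    using gaussian_approximate_identity[OF assms(1,2), of x] gaussian_approximate_identity[OF assms(3,4), of x]
      eq[OF gaussian_schwartz] by (simp add: LIMSEQ_unique del: of_nat_Suc)
qed

section \<open>Integrable functions as bounded distributions\<close>

lemma schwartz_bounded:
  assumes "\<phi> \<in> schwartz"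
  obtains C where "\<And>x. norm (\<phi> x) \<le> C"
proof -
  have "bounded (range (\<lambda>x. x ^ 0 *\<^sub>R nth_deriv 0 \<phi> x))"
    using assms unfolding schwartz_def by blast
  then show ?thesis using that by (auto simp: nth_deriv_def bounded_iff)
qed

lemma schwartz_measurable:
  assumes "\<phi> \<in> schwartz"
  shows "\<phi> \<in> borel_measurable borel"
proof -
  have "nth_deriv 0 \<phi> differentiable at x" for x
    using assms unfolding schwartz_def by blast
  then have "continuous_on UNIV \<phi>"
    by (auto simp: nth_deriv_def continuous_on_eq_continuous_at intro: differentiable_imp_continuous_within)
  then show ?thesis by (rule borel_measurable_continuous_onI)
qed

lemma integrable_mult_bounded:
  fixes g \<phi> :: "real \<Rightarrow> complex"
  assumes "integrable lborel g" "\<phi> \<in> borel_measurable borel" "\<And>x. norm (\<phi> x) \<le> C"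
  shows "integrable lborel (\<lambda>x. g x * \<phi> x)"
    and "norm (LBINT x. g x * \<phi> x) \<le> (LBINT x. norm (g x)) * C"
proof -
  have le: "norm (g x * \<phi> x) \<le> norm (g x) * C" for x
    unfolding norm_mult by (intro mult_left_mono assms) simp
  show i: "integrable lborel (\<lambda>x. g x * \<phi> x)"
  proof (rule Bochner_Integration.integrable_bound)
    show "integrable lborel (\<lambda>x. norm (g x) * C)" using assms by simp
    show "(\<lambda>x. g x * \<phi> x) \<in> borel_measurable lborel" using assms by simp
    show "AE x in lborel. norm (g x * \<phi> x) \<le> norm (norm (g x) * C)"
      using le by (auto intro!: AE_I2 order_trans[OF le])
  qed
  have "norm (LBINT x. g x * \<phi> x) \<le> (LBINT x. norm (g x * \<phi> x))"
    by (rule integral_norm_bound)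
  also have "\<dots> \<le> (LBINT x. norm (g x) * C)"
    using assms i by (intro integral_mono le) auto
  finally show "norm (LBINT x. g x * \<phi> x) \<le> (LBINT x. norm (g x)) * C" by simp
qed

lemma tempered_regular:
  assumes g: "integrable lborel g"
  shows "tempered (regular_distribution g)"
  unfolding tempered_def
proof (intro conjI ballI allI impI)
  fix \<phi> \<psi> :: "real \<Rightarrow> complex" and p q assume \<phi>: "\<phi> \<in> schwartz" and \<psi>: "\<psi> \<in> schwartz"
  have "integrable lborel (\<lambda>x. g x * \<phi> x)" if "\<phi> \<in> schwartz" for \<phi>
    using schwartz_bounded[OF that] integrable_mult_bounded(1)[OF g schwartz_measurable[OF that]] by metis
  note this[OF \<phi>] this[OF \<psi>]
  moreover have "(\<lambda>x. g x * (p * \<phi> x + q * \<psi> x)) = (\<lambda>x. p * (g x * \<phi> x) + q * (g x * \<psi> x))"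
    by (simp add: algebra_simps)
  ultimately show "regular_distribution g (\<lambda>x. p * \<phi> x + q * \<psi> x) = p * regular_distribution g \<phi> + q * regular_distribution g \<psi>"
    by (simp add: regular_distribution_def)
next
  fix \<Phi> :: "nat \<Rightarrow> real \<Rightarrow> complex"
  assume \<Phi>: "range \<Phi> \<subseteq> schwartz" "schwartz_tendsto_zero \<Phi>"
  define N where "N = (LBINT x. norm (g x))"
  have N: "N \<ge> 0" by (simp add: N_def)
  \<comment> \<open>The seminorm with m = k = 0 is the supremum norm, with respect to which pairing
    with an integrable g is continuous.\<close>
  have "uniform_limit UNIV (\<lambda>j x. x ^ 0 *\<^sub>R nth_deriv 0 (\<Phi> j) x) (\<lambda>_. 0) sequentially"
    using \<Phi>(2) unfolding schwartz_tendsto_zero_def by blast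
  then have lim: "uniform_limit UNIV \<Phi> (\<lambda>_. 0) sequentially"
    by (simp add: nth_deriv_def)
  show "(\<lambda>j. regular_distribution g (\<Phi> j)) \<longlonglongrightarrow> 0"
  proof (rule tendstoI)
    fix e :: real assume e: "e > 0"
    \<comment> \<open>The bound N e / (N + 1) < e also covers N = 0.\<close>
    have "\<forall>\<^sub>F j in sequentially. \<forall>x\<in>UNIV. dist (\<Phi> j x) 0 < e / (N + 1)"
      using lim N e by (intro uniform_limitD) auto
    then show "\<forall>\<^sub>F j in sequentially. dist (regular_distribution g (\<Phi> j)) 0 < e"
    proof eventually_elim
      case (elim j)
      have "norm (LBINT x. g x * \<Phi> j x) \<le> N * (e / (N + 1))"
        unfolding N_def[symmetric] using \<Phi>(1) elim
        by (intro integrable_mult_bounded(2)[OF g, folded N_def] schwartz_measurable) (auto intro: less_imp_le)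
      also have "\<dots> < e" using N e by (simp add: field_simps)
      finally show ?case by (simp add: regular_distribution_def)
    qed
  qed
qed

lemma bounded_distribution_regular:
  assumes g: "integrable lborel g"
  shows "bounded_distribution (regular_distribution g)"
  unfolding bounded_distribution_def
proof (intro conjI ballI tempered_regular[OF g])
  fix \<phi> assume \<phi>: "\<phi> \<in> schwartz"
  obtain C where C: "\<And>x. norm (\<phi> x) \<le> C" using schwartz_bounded[OF \<phi>] by blast
  have [measurable]: "\<phi> \<in> borel_measurable borel" by (rule schwartz_measurable[OF \<phi>])
  have "norm (dist_conv (regular_distribution g) \<phi> x) \<le> (LBINT x. norm (g x)) * C" for x
    unfolding dist_conv_def regular_distribution_def using C
    by (intro integrable_mult_bounded(2)[OF g]) auto
  then show "\<exists>C. AE x in lborel. norm (dist_conv (regular_distribution g) \<phi> x) \<le> C" by blast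
qed

section \<open>Poisson integrals\<close>

lemma lborel_Fubini:
  fixes f :: "real \<Rightarrow> real \<Rightarrow> complex"
  assumes [measurable]: "case_prod f \<in> borel_measurable (borel \<Otimes>\<^sub>M borel)"
    and fin: "(\<integral>\<^sup>+x. (\<integral>\<^sup>+y. ennreal (norm (f x y)) \<partial>lborel) \<partial>lborel) < \<infinity>"
  shows "(LBINT x. LBINT y. f x y) = (LBINT y. LBINT x. f x y)"
proof -
  have "(\<integral>\<^sup>+z. ennreal (norm (case_prod f z)) \<partial>(lborel \<Otimes>\<^sub>M lborel)) < \<infinity>"
    using fin by (subst lborel.nn_integral_fst[symmetric]) simp_all
  then have "integrable (lborel \<Otimes>\<^sub>M lborel) (case_prod f)"
    by (intro integrableI_bounded) simp_all
  from lborel_pair.Fubini_integral[OF this] show ?thesis by simp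
qed

lemma poisson_t_nonneg: "t > 0 \<Longrightarrow> 0 \<le> poisson_t t x"
  by (simp add: poisson_t_def poisson_def)

lemma poisson_t_le: "t > 0 \<Longrightarrow> poisson_t t x \<le> 1 / (pi * t)"
  unfolding poisson_t_def poisson_def by (simp add: divide_simps mult_le_cancel_left1 add_pos_nonneg)

lemma poisson_t_minus: "poisson_t t (- x) = poisson_t t x"
  by (simp add: poisson_t_def poisson_def)

lemma poisson_t_dilate: "u > 0 \<Longrightarrow> t > 0 \<Longrightarrow> u * poisson_t (t * u) (u * x) = poisson_t t x"
  by (simp add: poisson_t_def)

lemma poisson_t_continuous: "t > 0 \<Longrightarrow> continuous_on UNIV (poisson_t t)"
  unfolding poisson_t_def poisson_def
  by (intro continuous_intros) (auto simp: add_pos_nonneg less_imp_neq[symmetric])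

lemma poisson_t_measurable [measurable]: "poisson_t t \<in> borel_measurable borel"
  unfolding poisson_t_def[abs_def] poisson_def by measurable

lemma poisson_t_nn_integral_finite:
  assumes "t > 0"
  shows "(\<integral>\<^sup>+x. ennreal (poisson_t t x) \<partial>lborel) < \<infinity>"
proof -
  have half: "(\<integral>\<^sup>+x\<in>{0..}. ennreal (poisson_t 1 x) \<partial>lborel) < \<infinity>"
  proof -
    have "((\<lambda>x. arctan x / pi) \<longlongrightarrow> (pi / 2) / pi) at_top"
      by (intro tendsto_intros tendsto_arctan_at_top) simp
    then have "(\<integral>\<^sup>+x\<in>{0..}. ennreal (poisson_t 1 x) \<partial>lborel) = ennreal ((pi / 2) / pi - arctan 0 / pi)"
      by (intro nn_integral_FTC_atLeast)
         (auto intro!: derivative_eq_intros simp: poisson_t_nonneg, simp add: poisson_t_def poisson_def field_simps)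
    then show ?thesis by (simp only: ennreal_less_top infinity_ennreal_def)
  qed
  have "(\<integral>\<^sup>+x\<in>{..0}. ennreal (poisson_t 1 x) \<partial>lborel) = (\<integral>\<^sup>+x\<in>{0..}. ennreal (poisson_t 1 x) \<partial>lborel)"
    using nn_integral_real_affine[of "\<lambda>x. ennreal (poisson_t 1 x) * indicator {..0} x" "-1" 0]
    by (simp add: poisson_t_minus) (simp add: indicator_def)
  moreover have "(\<integral>\<^sup>+x. ennreal (poisson_t 1 x) \<partial>lborel)
     \<le> (\<integral>\<^sup>+x. ennreal (poisson_t 1 x) * indicator {..0} x + ennreal (poisson_t 1 x) * indicator {0..} x \<partial>lborel)"
    by (intro nn_integral_mono) (auto split: split_indicator)
  moreover have "\<dots> = (\<integral>\<^sup>+x\<in>{..0}. ennreal (poisson_t 1 x) \<partial>lborel) + (\<integral>\<^sup>+x\<in>{0..}. ennreal (poisson_t 1 x) \<partial>lborel)"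
    by (rule nn_integral_add) measurable
  ultimately have "(\<integral>\<^sup>+x. ennreal (poisson_t 1 x) \<partial>lborel) < \<infinity>"
    using half by (simp add: le_less_trans)
  moreover have "(\<integral>\<^sup>+x. ennreal (poisson_t 1 x) \<partial>lborel)
      = ennreal (1 / t) * (\<integral>\<^sup>+x. ennreal (poisson_t 1 (x / t)) \<partial>lborel)"
    using assms nn_integral_real_affine[of "\<lambda>x. ennreal (poisson_t 1 x)" "1 / t" 0] by simp
  moreover have "\<dots> = (\<integral>\<^sup>+x. ennreal (1 / t) * ennreal (poisson_t 1 (x / t)) \<partial>lborel)"
    by (rule nn_integral_cmult[symmetric]) measurable
  moreover have "\<dots> = (\<integral>\<^sup>+x. ennreal (poisson_t t x) \<partial>lborel)"
    using assms by (simp add: poisson_t_def flip: ennreal_mult')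
  ultimately show ?thesis by simp
qed

text \<open>The ordinary convolution. The kernel is bounded by 1/(pi t), so the integral exists at
  every x for integrable g; \<open>poisson_conv_regular\<close> identifies it with
  \<open>poisson_conv\<close>.\<close>

definition poisson_integral :: "real \<Rightarrow> (real \<Rightarrow> complex) \<Rightarrow> real \<Rightarrow> complex" where
  "poisson_integral t g x = (LBINT w. g w * of_real (poisson_t t (x - w)))"

lemma norm_poisson_t_le:
  "t > 0 \<Longrightarrow> norm (complex_of_real (poisson_t t x)) \<le> 1 / (pi * t)"
  using poisson_t_le poisson_t_nonneg by (simp only: norm_of_real abs_of_nonneg)

lemma poisson_integral_bounded:
  assumes "integrable lborel g" "t > 0"
  shows "bounded (range (poisson_integral t g))"
proof -
  have "norm (poisson_integral t g x) \<le> (LBINT w. norm (g w)) * (1 / (pi * t))" for x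
    unfolding poisson_integral_def
    by (rule integrable_mult_bounded(2)[OF assms(1)]) (use norm_poisson_t_le assms in auto)
  then show ?thesis unfolding bounded_iff by blast
qed

lemma poisson_integral_continuous:
  assumes g: "integrable lborel g" and t: "t > 0"
  shows "continuous_on UNIV (poisson_integral t g)"
  unfolding continuous_on_eq_continuous_at[OF open_UNIV]
proof
  have [measurable]: "g \<in> borel_measurable borel" using g by simp
  fix x
  show "isCont (poisson_integral t g) x"
    unfolding continuous_at_sequentially
  proof (intro allI impI)
    fix X assume X: "X \<longlonglongrightarrow> x"
    have "(\<lambda>j. LBINT w. g w * of_real (poisson_t t (X j - w))) \<longlonglongrightarrow> (LBINT w. g w * of_real (poisson_t t (x - w)))"
    proof (rule integral_dominated_convergence)
      show "integrable lborel (\<lambda>w. norm (g w) * (1 / (pi * t)))" using g by simp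
      show "AE w in lborel. (\<lambda>j. g w * of_real (poisson_t t (X j - w))) \<longlonglongrightarrow> g w * of_real (poisson_t t (x - w))"
      proof (intro AE_I2 tendsto_mult tendsto_const tendsto_of_real)
        fix w
        have "isCont (poisson_t t) (x - w)"
          using poisson_t_continuous[OF t] by (simp add: continuous_on_eq_continuous_at)
        moreover have "(\<lambda>j. X j - w) \<longlonglongrightarrow> x - w" by (intro tendsto_intros X)
        ultimately show "(\<lambda>j. poisson_t t (X j - w)) \<longlonglongrightarrow> poisson_t t (x - w)"
          by (rule isCont_tendsto_compose)
      qed
      show "AE w in lborel. norm (g w * of_real (poisson_t t (X j - w))) \<le> norm (g w) * (1 / (pi * t))" for j
        unfolding norm_mult by (intro AE_I2 mult_left_mono norm_poisson_t_le t) simp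
    qed measurable
    then show "(poisson_integral t g \<circ> X) \<longlonglongrightarrow> poisson_integral t g x"
      by (simp add: poisson_integral_def o_def)
  qed
qed

text \<open>Both sides are the double integral of g(w) P_t(v) \<phi>(w + v): the left one with x = w
  + v, the right one with y = -v. It converges absolutely because \<phi> is bounded and g and P_t
  are integrable.\<close>

lemma poisson_integral_pairing:
  assumes g: "integrable lborel g" and t: "t > 0" and \<phi>: "\<phi> \<in> schwartz"
  shows "(LBINT x. poisson_integral t g x * \<phi> x) =
    (LBINT y. dist_conv (regular_distribution g) (\<lambda>w. \<phi> (- w)) y * of_real (poisson_t t (- y)))"
proof -
  have [measurable]: "g \<in> borel_measurable borel" using g by simp
  have [measurable]: "\<phi> \<in> borel_measurable borel" by (rule schwartz_measurable[OF \<phi>])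
  obtain C where C: "\<And>x. norm (\<phi> x) \<le> C" using schwartz_bounded[OF \<phi>] by blast
  have "0 \<le> C" using C[of 0] norm_ge_zero[of "\<phi> 0"] by linarith
  define h where "h = (\<lambda>w v. g w * of_real (poisson_t t v) * \<phi> (w + v))"
  have gfin: "(\<integral>\<^sup>+w. ennreal (norm (g w)) \<partial>lborel) < \<infinity>"
    using g unfolding integrable_iff_bounded by simp
  have fin: "(\<integral>\<^sup>+w. (\<integral>\<^sup>+v. ennreal (norm (h w v)) \<partial>lborel) \<partial>lborel) < \<infinity>"
  proof -
    have "(\<integral>\<^sup>+w. (\<integral>\<^sup>+v. ennreal (norm (h w v)) \<partial>lborel) \<partial>lborel)
      \<le> (\<integral>\<^sup>+w. (\<integral>\<^sup>+v. ennreal C * ennreal (norm (g w)) * ennreal (poisson_t t v) \<partial>lborel) \<partial>lborel)"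
    proof (intro nn_integral_mono)
      fix w v
      have "norm (h w v) \<le> C * norm (g w) * poisson_t t v"
        using mult_left_mono[OF C[of "w + v"], of "norm (g w) * poisson_t t v"] poisson_t_nonneg[OF t, of v]
        by (simp add: h_def norm_mult mult_ac)
      then show "ennreal (norm (h w v)) \<le> ennreal C * ennreal (norm (g w)) * ennreal (poisson_t t v)"
        using \<open>0 \<le> C\<close> by (simp add: ennreal_mult'[symmetric] poisson_t_nonneg[OF t] ennreal_leI)
    qed
    also have "\<dots> = (\<integral>\<^sup>+w. ennreal (norm (g w)) * (ennreal C * (\<integral>\<^sup>+v. ennreal (poisson_t t v) \<partial>lborel)) \<partial>lborel)"
      by (intro nn_integral_cong) (subst nn_integral_cmult, simp, simp add: mult_ac)
    also have "\<dots> = (\<integral>\<^sup>+w. ennreal (norm (g w)) \<partial>lborel) * (ennreal C * (\<integral>\<^sup>+v. ennreal (poisson_t t v) \<partial>lborel))"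
      by (rule nn_integral_multc) measurable
    also have "\<dots> < \<infinity>"
      using gfin poisson_t_nn_integral_finite[OF t] by (simp add: ennreal_mult_less_top)
    finally show ?thesis .
  qed
  have shift: "(\<integral>\<^sup>+x. F (x - w) \<partial>lborel) = (\<integral>\<^sup>+x. F x \<partial>lborel)" if "F \<in> borel_measurable borel" for F :: "real \<Rightarrow> ennreal" and w
    using nn_integral_real_affine[OF that, of 1 "- w"] by simp
  have shift': "(LBINT x. F (x - w)) = (LBINT x. F x)" for F :: "real \<Rightarrow> complex" and w
    using lborel_integral_real_affine[of 1 F "- w"] by simp
  have "(LBINT x. poisson_integral t g x * \<phi> x) = (LBINT x. LBINT w. h w (x - w))"
    unfolding poisson_integral_def h_def by (intro Bochner_Integration.integral_cong) simp_all
  also have "\<dots> = (LBINT w. LBINT x. h w (x - w))"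
  proof (rule lborel_Fubini[symmetric])
    show "(\<lambda>(w, x). h w (x - w)) \<in> borel_measurable (borel \<Otimes>\<^sub>M borel)"
      unfolding h_def by measurable
    have "(\<integral>\<^sup>+w. (\<integral>\<^sup>+x. ennreal (norm (h w (x - w))) \<partial>lborel) \<partial>lborel)
        = (\<integral>\<^sup>+w. (\<integral>\<^sup>+v. ennreal (norm (h w v)) \<partial>lborel) \<partial>lborel)"
      unfolding h_def by (intro nn_integral_cong shift[where F = "\<lambda>v. ennreal (norm (h w v))" for w, unfolded h_def]) measurable
    then show "(\<integral>\<^sup>+w. (\<integral>\<^sup>+x. ennreal (norm (h w (x - w))) \<partial>lborel) \<partial>lborel) < \<infinity>"
      using fin by simp
  qed
  also have "\<dots> = (LBINT w. LBINT v. h w v)"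
    by (simp add: shift'[of "h w" w for w])
  also have "\<dots> = (LBINT v. LBINT w. h w v)"
    by (rule lborel_Fubini[OF _ fin]) (simp add: h_def)
  also have "\<dots> = (LBINT y. LBINT w. h w (- y))"
    using lborel_integral_real_affine[of "-1" "\<lambda>v. LBINT w. h w v" 0] by simp
  also have "\<dots> = (LBINT y. dist_conv (regular_distribution g) (\<lambda>w. \<phi> (- w)) y * of_real (poisson_t t (- y)))"
    unfolding dist_conv_def regular_distribution_def h_def
    by (intro Bochner_Integration.integral_cong) (simp_all add: mult_ac flip: integral_mult_right_zero integral_mult_left_zero)
  finally show ?thesis .
qed

lemma poisson_conv_regular:
  assumes "integrable lborel g" "t > 0"
  shows "poisson_conv t (regular_distribution g) = poisson_integral t g"
  unfolding poisson_conv_def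
proof (rule the_equality)
  show P: "continuous_on UNIV (poisson_integral t g) \<and> bounded (range (poisson_integral t g)) \<and>
    (\<forall>\<phi>\<in>schwartz. (LBINT x. poisson_integral t g x * \<phi> x) =
      (LBINT y. dist_conv (regular_distribution g) (\<lambda>w. \<phi> (- w)) y * of_real (poisson_t t (- y))))"
    using poisson_integral_continuous poisson_integral_bounded poisson_integral_pairing assms by blast
  show "h = poisson_integral t g" if "continuous_on UNIV h \<and> bounded (range h) \<and>
    (\<forall>\<phi>\<in>schwartz. (LBINT x. h x * \<phi> x) =
      (LBINT y. dist_conv (regular_distribution g) (\<lambda>w. \<phi> (- w)) y * of_real (poisson_t t (- y))))" for h
    using that P by (intro schwartz_pairing_unique) auto
qed

section \<open>The Poisson maximal function\<close>

lemma poisson_maximal_regular: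
  assumes "integrable lborel g"
  shows "poisson_maximal (regular_distribution g) x = (SUP t\<in>{0<..}. ennreal (norm (poisson_integral t g x)))"
  unfolding poisson_maximal_def using poisson_conv_regular[OF assms] by (intro SUP_cong) auto

text \<open>The supremum runs over uncountably many t, but every Poisson integral is continuous, so
  the superlevel sets are unions of open sets.\<close>

lemma poisson_maximal_measurable:
  assumes "integrable lborel g"
  shows "poisson_maximal (regular_distribution g) \<in> borel_measurable borel"
proof (rule borel_measurableI_greater)
  fix y :: ennreal
  have "{x \<in> space borel. y < poisson_maximal (regular_distribution g) x} =
    (\<Union>t\<in>{0<..}. {x. y < ennreal (norm (poisson_integral t g x))})"
    by (auto simp: poisson_maximal_regular[OF assms] less_SUP_iff)
  moreover have "open {x. y < ennreal (norm (poisson_integral t g x))}" if "t > 0" for t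
    using poisson_integral_continuous[OF assms that]
    by (intro open_Collect_less continuous_on_const continuous_on_ennreal continuous_on_norm)
  ultimately show "{x \<in> space borel. y < poisson_maximal (regular_distribution g) x} \<in> sets borel"
    by (auto intro!: borel_open open_UN)
qed

section \<open>Averages over dilations\<close>

lemma nn_integral_dilate:
  fixes g :: "real \<Rightarrow> ennreal"
  assumes "g \<in> borel_measurable borel" "u > 0"
  shows "(\<integral>\<^sup>+x. g (x * u) \<partial>lborel) = ennreal (1 / u) * (\<integral>\<^sup>+x. g x \<partial>lborel)"
proof -
  have "(\<integral>\<^sup>+x. g x \<partial>lborel) = ennreal u * (\<integral>\<^sup>+x. g (x * u) \<partial>lborel)"
    using nn_integral_real_affine[OF assms(1), of u 0] assms(2) by (simp add: mult.commute)
  then have "ennreal (1 / u) * (\<integral>\<^sup>+x. g x \<partial>lborel) = (ennreal (1 / u) * ennreal u) * (\<integral>\<^sup>+x. g (x * u) \<partial>lborel)"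
    by (simp add: mult.assoc)
  also have "ennreal (1 / u) * ennreal u = 1"
    using assms(2) by (simp flip: ennreal_mult')
  finally show ?thesis by simp
qed

text \<open>What the passage to the Hardy space uses of the kernel. In the application \<kappa> is
  the Fox kernel cut off to u \<ge> 1. The weight 1/u is the Jacobian of the dilation x -> x
  u.\<close>

locale dilation_average =
  fixes \<kappa> :: "real \<Rightarrow> complex"
  assumes \<kappa>_measurable [measurable]: "\<kappa> \<in> borel_measurable borel"
    and \<kappa>_nonpos: "\<And>u. u \<le> 0 \<Longrightarrow> \<kappa> u = 0"
    and \<kappa>_mass: "(\<integral>\<^sup>+u. ennreal (norm (\<kappa> u) / u) \<partial>lborel) < \<infinity>"
begin

definition mass :: ennreal where
  "mass = (\<integral>\<^sup>+u. ennreal (norm (\<kappa> u) / u) \<partial>lborel)"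

definition average :: "(real \<Rightarrow> complex) \<Rightarrow> real \<Rightarrow> complex" where
  "average f x = (LBINT u. \<kappa> u * f (x * u))"

text \<open>Applied to |f| for the existence of the average, and to the maximal function of f for
  the norm bound.\<close>

lemma nn_integral_average:
  fixes g :: "real \<Rightarrow> ennreal"
  assumes [measurable]: "g \<in> borel_measurable borel"
  shows "(\<integral>\<^sup>+x. (\<integral>\<^sup>+u. ennreal (norm (\<kappa> u)) * g (x * u) \<partial>lborel) \<partial>lborel) = mass * (\<integral>\<^sup>+x. g x \<partial>lborel)"
proof -
  have "(\<integral>\<^sup>+x. (\<integral>\<^sup>+u. ennreal (norm (\<kappa> u)) * g (x * u) \<partial>lborel) \<partial>lborel)
    = (\<integral>\<^sup>+u. (\<integral>\<^sup>+x. ennreal (norm (\<kappa> u)) * g (x * u) \<partial>lborel) \<partial>lborel)"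
    by (rule lborel_pair.Fubini') measurable
  also have "\<dots> = (\<integral>\<^sup>+u. ennreal (norm (\<kappa> u) / u) * (\<integral>\<^sup>+x. g x \<partial>lborel) \<partial>lborel)"
  proof (rule nn_integral_cong)
    fix u :: real
    show "(\<integral>\<^sup>+x. ennreal (norm (\<kappa> u)) * g (x * u) \<partial>lborel) = ennreal (norm (\<kappa> u) / u) * (\<integral>\<^sup>+x. g x \<partial>lborel)"
    proof (cases "u > 0")
      case True
      then show ?thesis
        by (subst nn_integral_cmult) (simp_all add: nn_integral_dilate ennreal_mult'[symmetric] mult.assoc[symmetric])
    qed (simp add: \<kappa>_nonpos)
  qed
  also have "\<dots> = mass * (\<integral>\<^sup>+x. g x \<partial>lborel)"
    unfolding mass_def by (rule nn_integral_multc) measurable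
  finally show ?thesis .
qed

lemma nn_integral_norm_average_finite:
  assumes f: "integrable lborel f"
  shows "(\<integral>\<^sup>+x. (\<integral>\<^sup>+u. ennreal (norm (\<kappa> u * f (x * u))) \<partial>lborel) \<partial>lborel) < \<infinity>"
proof -
  have [measurable]: "f \<in> borel_measurable borel" using f by simp
  have "(\<integral>\<^sup>+x. (\<integral>\<^sup>+u. ennreal (norm (\<kappa> u * f (x * u))) \<partial>lborel) \<partial>lborel) = mass * (\<integral>\<^sup>+x. ennreal (norm (f x)) \<partial>lborel)"
    using nn_integral_average[of "\<lambda>x. ennreal (norm (f x))"] by (simp add: norm_mult ennreal_mult)
  also have "\<dots> < \<infinity>"
    using f \<kappa>_mass by (simp add: integrable_iff_bounded mass_def ennreal_mult_less_top)
  finally show ?thesis .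
qed

text \<open>At the exceptional points the Bochner integral in \<open>average\<close> takes its
  default value 0.\<close>

lemma average_AE_integrable:
  assumes f: "integrable lborel f"
  shows "AE x in lborel. integrable lborel (\<lambda>u. \<kappa> u * f (x * u))"
proof -
  have [measurable]: "f \<in> borel_measurable borel" using f by simp
  have "AE x in lborel. (\<integral>\<^sup>+u. ennreal (norm (\<kappa> u * f (x * u))) \<partial>lborel) \<noteq> \<infinity>"
    using nn_integral_norm_average_finite[OF f] by (intro nn_integral_PInf_AE) auto
  then show ?thesis
    by eventually_elim (auto intro!: integrableI_bounded simp: less_top)
qed

lemma average_integrable:
  assumes f: "integrable lborel f"
  shows "integrable lborel (average f)"
proof (rule integrableI_bounded)
  have [measurable]: "f \<in> borel_measurable borel" using f by simp
  show "average f \<in> borel_measurable lborel"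
    unfolding average_def[abs_def] by measurable
  have "(\<integral>\<^sup>+x. ennreal (norm (average f x)) \<partial>lborel) \<le> (\<integral>\<^sup>+x. (\<integral>\<^sup>+u. ennreal (norm (\<kappa> u * f (x * u))) \<partial>lborel) \<partial>lborel)"
    unfolding average_def using average_AE_integrable[OF f]
    by (intro nn_integral_mono_AE) (auto elim!: eventually_mono intro: integral_norm_bound_ennreal)
  then show "(\<integral>\<^sup>+x. ennreal (norm (average f x)) \<partial>lborel) < \<infinity>"
    using nn_integral_norm_average_finite[OF f] by (rule le_less_trans)
qed

text \<open>The Poisson kernels form a single dilation orbit, so averaging over dilations only changes
  the parameter of the Poisson integral.\<close>

lemma poisson_integral_average:
  assumes f: "integrable lborel f" and t: "t > 0"
  shows "poisson_integral t (average f) x = (LBINT u. \<kappa> u * poisson_integral (t * u) f (x * u))"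
proof -
  have [measurable]: "f \<in> borel_measurable borel" using f by simp
  define h where "h = (\<lambda>y u. \<kappa> u * f (y * u) * of_real (poisson_t t (x - y)))"
  \<comment> \<open>For fixed t the kernel is at most 1/(pi t), so absolute convergence reduces to
    that of the average itself.\<close>
  have "(\<integral>\<^sup>+y. (\<integral>\<^sup>+u. ennreal (norm (h y u)) \<partial>lborel) \<partial>lborel)
    \<le> (\<integral>\<^sup>+y. (\<integral>\<^sup>+u. ennreal (norm (\<kappa> u * f (y * u))) * ennreal (1 / (pi * t)) \<partial>lborel) \<partial>lborel)"
  proof (intro nn_integral_mono)
    fix y u
    have "norm (h y u) \<le> norm (\<kappa> u * f (y * u)) * (1 / (pi * t))"
      unfolding h_def norm_mult[of _ "of_real (poisson_t t (x - y))"]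
      by (intro mult_left_mono norm_poisson_t_le t) simp
    then show "ennreal (norm (h y u)) \<le> ennreal (norm (\<kappa> u * f (y * u))) * ennreal (1 / (pi * t))"
      using t by (simp flip: ennreal_mult'' add: ennreal_leI)
  qed
  also have "\<dots> = (\<integral>\<^sup>+y. (\<integral>\<^sup>+u. ennreal (norm (\<kappa> u * f (y * u))) \<partial>lborel) \<partial>lborel) * ennreal (1 / (pi * t))"
    by (simp add: nn_integral_multc)
  also have "\<dots> < \<infinity>"
    using nn_integral_norm_average_finite[OF f] by (simp add: ennreal_mult_less_top)
  finally have fin: "(\<integral>\<^sup>+y. (\<integral>\<^sup>+u. ennreal (norm (h y u)) \<partial>lborel) \<partial>lborel) < \<infinity>" .
  have "poisson_integral t (average f) x = (LBINT y. LBINT u. h y u)"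
    unfolding poisson_integral_def average_def h_def
    by (intro Bochner_Integration.integral_cong) simp_all
  also have "\<dots> = (LBINT u. LBINT y. h y u)"
    by (rule lborel_Fubini[OF _ fin]) (simp add: h_def)
  also have "\<dots> = (LBINT u. \<kappa> u * poisson_integral (t * u) f (x * u))"
  proof (rule Bochner_Integration.integral_cong[OF refl])
    fix u :: real
    show "(LBINT y. h y u) = \<kappa> u * poisson_integral (t * u) f (x * u)"
    proof (cases "u > 0")
      case True
      \<comment> \<open>The substitution w = u y brings out a factor u, which
        \<open>poisson_t_dilate\<close> absorbs when the parameter changes from t u to t.\<close>
      have "poisson_integral (t * u) f (x * u)
        = u *\<^sub>R (LBINT y. f (u * y) * of_real (poisson_t (t * u) (x * u - u * y)))"
        unfolding poisson_integral_def
        using lborel_integral_real_affine[of u "\<lambda>w. f w * of_real (poisson_t (t * u) (x * u - w))" 0] True by simp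
      also have "\<dots> = (LBINT y. u *\<^sub>R (f (u * y) * of_real (poisson_t (t * u) (x * u - u * y))))"
        by simp
      also have "\<dots> = (LBINT y. f (y * u) * of_real (poisson_t t (x - y)))"
      proof (rule Bochner_Integration.integral_cong[OF refl])
        fix y
        have "poisson_t t (x - y) = u * poisson_t (t * u) (x * u - u * y)"
          using poisson_t_dilate[OF True t, of "x - y"] by (simp add: algebra_simps)
        then show "u *\<^sub>R (f (u * y) * of_real (poisson_t (t * u) (x * u - u * y))) = f (y * u) * of_real (poisson_t t (x - y))"
          by (simp add: scaleR_conv_of_real mult_ac)
      qed
      finally show ?thesis by (simp add: h_def mult.assoc)
    qed (simp add: h_def \<kappa>_nonpos)
  qed
  finally show ?thesis .
qed

lemma poisson_maximal_average_le:
  assumes f: "integrable lborel f"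
  shows "poisson_maximal (regular_distribution (average f)) x
    \<le> (\<integral>\<^sup>+u. ennreal (norm (\<kappa> u)) * poisson_maximal (regular_distribution f) (x * u) \<partial>lborel)"
  unfolding poisson_maximal_regular[OF average_integrable[OF f]]
proof (rule SUP_least)
  fix t :: real assume "t \<in> {0<..}"
  then have t: "t > 0" by simp
  let ?F = "\<lambda>u. \<kappa> u * poisson_integral (t * u) f (x * u)"
  \<comment> \<open>If \<open>?F\<close> is not integrable, its Bochner integral is 0 and the bound
    is trivial.\<close>
  have "ennreal (norm (LBINT u. ?F u)) \<le> (\<integral>\<^sup>+u. ennreal (norm (?F u)) \<partial>lborel)"
    by (cases "integrable lborel ?F")
       (simp_all add: integral_norm_bound_ennreal not_integrable_integral_eq)
  also have "\<dots> \<le> (\<integral>\<^sup>+u. ennreal (norm (\<kappa> u)) * poisson_maximal (regular_distribution f) (x * u) \<partial>lborel)"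
  proof (rule nn_integral_mono)
    fix u :: real
    show "ennreal (norm (?F u)) \<le> ennreal (norm (\<kappa> u)) * poisson_maximal (regular_distribution f) (x * u)"
    proof (cases "u > 0")
      case True
      \<comment> \<open>The scale t u is again positive, hence one of those in the supremum at the
        point x u.\<close>
      then have "ennreal (norm (poisson_integral (t * u) f (x * u))) \<le> poisson_maximal (regular_distribution f) (x * u)"
        unfolding poisson_maximal_regular[OF f] using t by (intro SUP_upper) simp
      then show ?thesis by (simp add: norm_mult ennreal_mult mult_left_mono)
    qed (simp add: \<kappa>_nonpos)
  qed
  finally show "ennreal (norm (poisson_integral t (average f) x))
    \<le> (\<integral>\<^sup>+u. ennreal (norm (\<kappa> u)) * poisson_maximal (regular_distribution f) (x * u) \<partial>lborel)"
    by (simp add: poisson_integral_average[OF f t])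
qed

lemma H1_fun_norm_average_le:
  assumes f: "integrable lborel f"
  shows "H1_fun_norm (average f) \<le> mass * H1_fun_norm f"
proof -
  have [measurable]: "poisson_maximal (regular_distribution f) \<in> borel_measurable borel"
    by (rule poisson_maximal_measurable[OF f])
  have "H1_fun_norm (average f)
    \<le> (\<integral>\<^sup>+x. (\<integral>\<^sup>+u. ennreal (norm (\<kappa> u)) * poisson_maximal (regular_distribution f) (x * u) \<partial>lborel) \<partial>lborel)"
    unfolding H1_fun_norm_def H1_norm_def by (intro nn_integral_mono poisson_maximal_average_le f)
  also have "\<dots> = mass * H1_fun_norm f"
    unfolding H1_fun_norm_def H1_norm_def by (rule nn_integral_average) measurable
  finally show ?thesis .
qed

lemma average_in_H1_fun:
  assumes "f \<in> H1_fun"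
  shows "average f \<in> H1_fun"
proof -
  have f: "integrable lborel f" and "H1_fun_norm f < \<infinity>"
    using assms by (auto simp: H1_fun_def hardy_H1_def H1_fun_norm_def)
  then have "mass * H1_fun_norm f < \<infinity>"
    using \<kappa>_mass by (simp add: mass_def ennreal_mult_less_top)
  with H1_fun_norm_average_le[OF f] have "H1_fun_norm (average f) < \<infinity>"
    by (rule le_less_trans)
  then show ?thesis
    using average_integrable[OF f] bounded_distribution_regular poisson_maximal_measurable
    by (auto simp: H1_fun_def hardy_H1_def H1_fun_norm_def)
qed

end

section \<open>The theorem\<close>

text \<open>The loop is any one that encloses the poles. Finiteness of \<open>k2\<close> and
  integrability for almost every x are part of the conclusion, because otherwise the inequality
  could hold for the wrong reason: through an infinite constant or through the default value 0 of a
  divergent integral.\<close>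

theorem theorem3p3:
  fixes n :: nat and \<epsilon> \<xi> \<alpha> \<tau> :: "nat \<Rightarrow> real" and \<phi>1 \<phi>2 c :: real
  assumes "n \<ge> 1"
    and "\<And>k. k \<in> {1..n} \<Longrightarrow> \<epsilon> k > 0"
    and "\<And>k. k \<in> {1..n} \<Longrightarrow> \<xi> k > 0"
    and "\<And>k. k \<in> {1..n} \<Longrightarrow> \<alpha> k \<ge> 0"
    and "(\<Sum>k=1..n. 1 / \<xi> k) = (\<Sum>k=1..n. 1 / \<epsilon> k)"
    and "(\<Sum>k=1..n. \<alpha> k) > 0"
    and "Min ((\<lambda>k. \<tau> k * \<xi> k) ` {1..n}) > -1"
    and "left_loop_encloses \<phi>1 \<phi>2 c
           (fox_poles n (\<lambda>k. of_real (\<tau> k + 1 / \<xi> k)) (\<lambda>k. 1 / \<xi> k))"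
  shows "k2 \<phi>1 \<phi>2 c n \<epsilon> \<xi> \<tau> \<alpha> < \<infinity> \<and>
    (\<forall>f\<in>H1_fun.
       (AE x in lborel. set_integrable lborel {1..}
          (\<lambda>u. K_kernel \<phi>1 \<phi>2 c n \<epsilon> \<xi> \<tau> \<alpha> u * f (x * u))) \<and>
       K_op \<phi>1 \<phi>2 c n \<epsilon> \<xi> \<tau> \<alpha> f \<in> H1_fun \<and>
       H1_fun_norm (K_op \<phi>1 \<phi>2 c n \<epsilon> \<xi> \<tau> \<alpha> f)
         \<le> k2 \<phi>1 \<phi>2 c n \<epsilon> \<xi> \<tau> \<alpha> * H1_fun_norm f)"
proof -
  define a where "a = (\<lambda>k. \<tau> k + \<alpha> k + 1 / \<epsilon> k)"
  define b where "b = (\<lambda>k. \<tau> k + 1 / \<xi> k)"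
  define A where "A = (\<lambda>k. 1 / \<epsilon> k)"
  define B where "B = (\<lambda>k. 1 / \<xi> k)"
  interpret fox_parameters n a A b B
  proof
    show "b k > 0" if k: "k \<in> {1..n}" for k
    proof -
      have "Min ((\<lambda>k. \<tau> k * \<xi> k) ` {1..n}) \<le> \<tau> k * \<xi> k"
        using k by (intro Min_le) auto
      then have "\<tau> k * \<xi> k + 1 > 0" using assms(7) by linarith
      then have "(\<tau> k * \<xi> k + 1) / \<xi> k > 0" using assms(3)[OF k] by simp
      then show ?thesis using assms(3)[OF k] by (simp add: b_def add_divide_distrib)
    qed
    show "(\<Sum>k=1..n. b k) < (\<Sum>k=1..n. a k)"
      using assms(5,6) by (simp add: a_def b_def sum.distrib)
  qed (use assms in \<open>auto simp: A_def B_def\<close>)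
  have poles: "left_loop_encloses \<phi>1 \<phi>2 c (fox_poles n (\<lambda>k. of_real (b k)) B)"
    using assms(8) by (simp add: b_def B_def)
  have pole: "complex_of_real (- (b k / B k)) \<in> fox_poles n (\<lambda>k. of_real (b k)) B" if "k \<in> {1..n}" for k
    unfolding fox_poles_def mem_Collect_eq
    by (rule bexI[OF _ that]) (use B_pos[OF that] in simp)
  \<comment> \<open>The first pole of each factor is real, so a loop around it has one ray strictly
    below and one strictly above the real axis, away from all poles.\<close>
  have encl: "\<phi>1 < 0" "0 < \<phi>2" "- (b k / B k) < c" if "k \<in> {1..n}" for k
    using poles pole[OF that] unfolding left_loop_encloses_def by force+
  have \<phi>: "\<phi>1 \<noteq> 0" "\<phi>2 \<noteq> 0" using encl(1,2)[of 1] assms(1) by auto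
  \<comment> \<open>\<open>abscissa\<close> is attained at one of these first poles and hence lies
    to the left of c.\<close>
  have "Min ((\<lambda>k. b k / B k) ` {1..n}) \<in> (\<lambda>k. b k / B k) ` {1..n}"
    using assms(1) by (intro Min_in) auto
  then have c: "abscissa < c"
    using encl(3) unfolding abscissa_def by auto
  have K: "K_kernel \<phi>1 \<phi>2 c n \<epsilon> \<xi> \<tau> \<alpha> = kernel \<phi>1 \<phi>2 c"
    unfolding fun_eq_iff K_kernel_def kernel_def unfolding a_def b_def A_def B_def by simp
  define \<kappa> where "\<kappa> = (\<lambda>u. indicator {1..} u *\<^sub>R kernel \<phi>1 \<phi>2 c u)"
  have k2_eq: "(\<integral>\<^sup>+u. ennreal (norm (\<kappa> u) / u) \<partial>lborel) = k2 \<phi>1 \<phi>2 c n \<epsilon> \<xi> \<tau> \<alpha>"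
    unfolding k2_def K \<kappa>_def by (intro nn_integral_cong) (auto split: split_indicator)
  have k2: "k2 \<phi>1 \<phi>2 c n \<epsilon> \<xi> \<tau> \<alpha> < \<infinity>"
    unfolding k2_def K by (rule kernel_mass_finite[OF c \<phi>])
  interpret dilation_average \<kappa>
  proof
    show "\<kappa> \<in> borel_measurable borel"
      unfolding \<kappa>_def by (rule kernel_measurable[OF c \<phi>])
    show "(\<integral>\<^sup>+u. ennreal (norm (\<kappa> u) / u) \<partial>lborel) < \<infinity>"
      using k2 k2_eq by simp
  qed (simp add: \<kappa>_def)
  have K_op: "K_op \<phi>1 \<phi>2 c n \<epsilon> \<xi> \<tau> \<alpha> = average"
    unfolding fun_eq_iff K_op_def average_def set_lebesgue_integral_def K unfolding \<kappa>_def by simp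
  have mass: "mass = k2 \<phi>1 \<phi>2 c n \<epsilon> \<xi> \<tau> \<alpha>"
    by (simp add: mass_def k2_eq)
  have "AE x in lborel. set_integrable lborel {1..} (\<lambda>u. K_kernel \<phi>1 \<phi>2 c n \<epsilon> \<xi> \<tau> \<alpha> u * f (x * u))"
    if "f \<in> H1_fun" for f
    using average_AE_integrable[of f] that by (simp add: H1_fun_def set_integrable_def K \<kappa>_def)
  moreover have "H1_fun_norm (average f) \<le> k2 \<phi>1 \<phi>2 c n \<epsilon> \<xi> \<tau> \<alpha> * H1_fun_norm f" if "f \<in> H1_fun" for f
    using H1_fun_norm_average_le[of f] that by (simp add: H1_fun_def mass)
  ultimately show ?thesis
    using k2 average_in_H1_fun unfolding K_op by blast
qed

end
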